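(* Let $\mathbb{D}_2=\left\{\lambda\in\mathbb{R}\;\middle|\;\exists\,\mathbf{v}\in\mathbb{R}^2:\ \limsup_{t\to\infty} t\cdot\psi_{\mathbf{v}}^2(t)=\lambda\right\}$. Then $$\mathbb{D}_2=\left[0,\frac{2}{\sqrt{3}}\right].$$
   Context: For $x\in\mathbb{R}$, $\|x\|$ denotes the distance from $x$ to the nearest integer. For $\mathbf{v}=(v_1,v_2)\in\mathbb{R}^2$ and $t\geqslant 1$, the two-dimensional irrationality measure function (with respect to the Euclidean norm) is $$\psi_{\mathbf{v}}(t)=\min_{1\leqslant q\leqslant t,\ q\in\mathbb{N}}\sqrt{\|qv_1\|^2+\|qv_2\|^2}.$$ The set $\mathbb{D}_2$ is called the two-dimensional Dirichlet spectrum. *)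

theory Defs
  imports "HOL-Analysis.Analysis"
begin

definition dist_nearest_int :: "real \<Rightarrow> real" where
  "dist_nearest_int x = infdist x \<int>"

(* The index set is finite, and for t \<ge> 1 it is nonempty, so the minimum is attained;
   the value for t < 1 is unspecified. *)
definition irrationality_measure :: "real ^ 2 \<Rightarrow> real \<Rightarrow> real" where
  "irrationality_measure v t =
     Min ((\<lambda>q. sqrt ((dist_nearest_int (real q * v $ 1))\<^sup>2 + (dist_nearest_int (real q * v $ 2))\<^sup>2))
          ` {q :: nat. 1 \<le> q \<and> real q \<le> t})"

(* The limit superior is taken in the extended reals, so that it always exists;
   it is then required to be the finite number l. *)
definition dirichlet_spectrum_2 :: "real set" where
  "dirichlet_spectrum_2 =
     {l. \<exists>v :: real ^ 2.
        Limsup at_top (\<lambda>t :: real. ereal (t * (irrationality_measure v t)\<^sup>2)) = ereal l}"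

end

theory Submission
  imports Defs
begin

text \<open>
  Upper bound: the points \<open>q v\<close> with \<open>0 \<le> q \<le> n\<close> have mutual distance at least \<open>\<psi>(n)\<close> modulo the
  integer points, so they form a periodic planar packing of density \<open>n + 1\<close>. By Thue's theorem on
  disc packings, proved here with truncated Voronoi cells, \<open>(n + 1) \<psi>(n)\<^sup>2 \<le> 2 / sqrt 3\<close>.

  Attainment: let \<open>r\<close> be a rational point with denominator \<open>Q\<close>. The multiples of \<open>r\<close> modulo the
  integer points form a planar lattice of covolume \<open>1 / Q\<close>, so just before \<open>t = Q\<close> the value of
  \<open>t \<psi>\<^sub>r(t)\<^sup>2\<close> is the squared minimum of this lattice divided by its covolume, which can be any number
  in \<open>(0, 2 / sqrt 3]\<close>. From \<open>r\<close> one passes to a very close rational point \<open>r'\<close> of much larger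
  denominator \<open>Q'\<close> whose lattice has nearly the prescribed shape. Between \<open>Q\<close> and \<open>Q'\<close> only one
  further best approximation matters, and the local maximum of \<open>t \<psi>(t)\<^sup>2\<close> which it ends is
  negligible. The limit of a sequence of such rational points has the prescribed limit superior.
\<close>

section \<open>Distance to the Gaussian integers\<close>

text \<open>The quotient norm on the complex numbers modulo \<open>gauss_ints\<close>, written by
  coordinates so that it matches \<open>irrationality_measure\<close> term by term.\<close>

definition torus_norm :: "complex \<Rightarrow> real" where
  "torus_norm z = sqrt ((dist_nearest_int (Re z))\<^sup>2 + (dist_nearest_int (Im z))\<^sup>2)"

definition gauss_ints :: "complex set" where
  "gauss_ints = {Complex (of_int m) (of_int n) | m n. True}"

lemma gauss_ints_0: "0 \<in> gauss_ints"
  unfolding gauss_ints_def by (auto intro!: exI[of _ 0] simp: complex_eq_iff)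

lemma gauss_ints_add: "x \<in> gauss_ints \<Longrightarrow> y \<in> gauss_ints \<Longrightarrow> x + y \<in> gauss_ints"
  unfolding gauss_ints_def
  by (force simp: complex_eq_iff simp flip: of_int_add)

lemma gauss_ints_uminus: "x \<in> gauss_ints \<Longrightarrow> - x \<in> gauss_ints"
  unfolding gauss_ints_def
  by (force simp: complex_eq_iff simp flip: of_int_minus)

lemma gauss_ints_diff: "x \<in> gauss_ints \<Longrightarrow> y \<in> gauss_ints \<Longrightarrow> x - y \<in> gauss_ints"
  using gauss_ints_add[OF _ gauss_ints_uminus, of x y] by simp

lemma gauss_ints_mult: "x \<in> gauss_ints \<Longrightarrow> of_int k * x \<in> gauss_ints"
  unfolding gauss_ints_def
  by (force simp: complex_eq_iff simp flip: of_int_mult)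

lemma dist_nearest_int_le: "dist_nearest_int x \<le> \<bar>x - of_int m\<bar>"
  unfolding dist_nearest_int_def by (metis Ints_of_int dist_real_def infdist_le)

lemma dist_nearest_int_nonneg: "0 \<le> dist_nearest_int x"
  unfolding dist_nearest_int_def by (rule infdist_nonneg)

lemma dist_nearest_int_attained: "\<exists>m. dist_nearest_int x = \<bar>x - of_int m\<bar>"
proof -
  have "(\<int> :: real set) \<noteq> {}"
    using Ints_0 by blast
  from infdist_attains_inf[OF closed_Ints this, of x] show ?thesis
    unfolding dist_nearest_int_def by (metis Ints_cases dist_real_def)
qed

lemma torus_norm_nonneg: "0 \<le> torus_norm z"
  by (simp add: torus_norm_def)

lemma torus_norm_le:
  assumes "g \<in> gauss_ints"
  shows "torus_norm z \<le> cmod (z - g)"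
proof -
  obtain m n where g: "g = Complex (of_int m) (of_int n)"
    using assms by (auto simp: gauss_ints_def)
  have "(dist_nearest_int (Re z))\<^sup>2 \<le> (Re z - of_int m)\<^sup>2"
    using dist_nearest_int_le[of "Re z" m] dist_nearest_int_nonneg[of "Re z"]
    by (metis abs_le_square_iff abs_of_nonneg)
  moreover have "(dist_nearest_int (Im z))\<^sup>2 \<le> (Im z - of_int n)\<^sup>2"
    using dist_nearest_int_le[of "Im z" n] dist_nearest_int_nonneg[of "Im z"]
    by (metis abs_le_square_iff abs_of_nonneg)
  ultimately show ?thesis
    unfolding torus_norm_def g cmod_def by simp
qed

text \<open>The two coordinates can be rounded independently, and the two nearest integers form one
  nearest Gaussian integer.\<close>

lemma torus_norm_attained: "\<exists>g\<in>gauss_ints. torus_norm z = cmod (z - g)"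
proof -
  obtain m where m: "dist_nearest_int (Re z) = \<bar>Re z - of_int m\<bar>"
    using dist_nearest_int_attained by blast
  obtain n where n: "dist_nearest_int (Im z) = \<bar>Im z - of_int n\<bar>"
    using dist_nearest_int_attained by blast
  have "torus_norm z = cmod (z - Complex (of_int m) (of_int n))"
    by (simp add: torus_norm_def m n cmod_def)
  then show ?thesis
    unfolding gauss_ints_def by blast
qed

lemma torus_norm_triangle: "torus_norm z \<le> torus_norm w + cmod (z - w)"
proof -
  obtain g where g: "g \<in> gauss_ints" "torus_norm w = cmod (w - g)"
    using torus_norm_attained by blast
  have "torus_norm z \<le> cmod (z - g)"
    using g torus_norm_le by blast
  also have "\<dots> \<le> cmod (w - g) + cmod (z - w)"
    using norm_triangle_ineq[of "w - g" "z - w"] by simp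
  finally show ?thesis
    using g by simp
qed

lemma torus_norm_le_1: "torus_norm z \<le> 1"
proof -
  have *: "dist_nearest_int x \<le> 1 / 2" for x
    using dist_nearest_int_le[of x "round x"] of_int_round_abs_le[of x] by linarith
  have "(dist_nearest_int x)\<^sup>2 \<le> (1 / 2)\<^sup>2" for x
    by (rule power_mono[OF * dist_nearest_int_nonneg])
  from this[of "Re z"] this[of "Im z"] show ?thesis
    unfolding torus_norm_def by (simp add: power2_eq_square)
qed

text \<open>The plane is identified with the complex numbers, so that the integer points become the
  Gaussian integers and \<^term>\<open>psi\<close> is the irrationality measure function.\<close>

definition psi :: "complex \<Rightarrow> real \<Rightarrow> real" where
  "psi c t = Min ((\<lambda>q. torus_norm (of_nat q * c)) ` {q :: nat. 1 \<le> q \<and> real q \<le> t})"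

lemma irrationality_measure_eq_psi:
  "irrationality_measure v = psi (Complex (v $ 1) (v $ 2))"
  unfolding irrationality_measure_def psi_def torus_norm_def by (intro ext) simp

lemma finite_nat_le_real: "finite {q :: nat. 1 \<le> q \<and> real q \<le> t}"
proof (rule finite_subset)
  show "{q :: nat. 1 \<le> q \<and> real q \<le> t} \<subseteq> {.. nat \<lfloor>t\<rfloor>}"
    by (auto simp: le_nat_floor)
qed simp

lemma psi_le: "1 \<le> q \<Longrightarrow> real q \<le> t \<Longrightarrow> psi c t \<le> torus_norm (of_nat q * c)"
  unfolding psi_def by (intro Min_le finite_imageI finite_nat_le_real) auto

lemma psi_attained:
  assumes "1 \<le> t"
  obtains q where "1 \<le> q" "real q \<le> t" "psi c t = torus_norm (of_nat q * c)"
proof -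
  have "psi c t \<in> (\<lambda>q. torus_norm (of_nat q * c)) ` {q :: nat. 1 \<le> q \<and> real q \<le> t}"
    unfolding psi_def
    by (intro Min_in finite_imageI finite_nat_le_real) (use assms in \<open>auto intro!: exI[of _ 1]\<close>)
  then show ?thesis
    using that by auto
qed

lemma psi_nonneg: "1 \<le> t \<Longrightarrow> 0 \<le> psi c t"
  by (metis psi_attained torus_norm_nonneg)

lemma psi_le_1: "1 \<le> t \<Longrightarrow> psi c t \<le> 1"
  by (metis psi_attained torus_norm_le_1)

text \<open>Lets lattice vectors bound \<open>psi\<close>: here \<open>z\<close> is the planar part
  of a vector of height \<open>q\<close>. Heights are integers because those of a
  \<open>lattice_frame\<close> are.\<close>

lemma psi_le_cmod:
  assumes "1 \<le> q" "of_int q \<le> t" "z - of_int q * c \<in> gauss_ints"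
  shows "psi c t \<le> cmod z"
proof -
  have "psi c t \<le> torus_norm (of_nat (nat q) * c)"
    using assms by (intro psi_le) auto
  also have "\<dots> \<le> cmod (of_nat (nat q) * c - - (z - of_int q * c))"
    by (intro torus_norm_le gauss_ints_uminus assms)
  also have "of_nat (nat q) * c - - (z - of_int q * c) = z"
    using assms(1) by simp
  finally show ?thesis .
qed

text \<open>A minimiser for \<open>d\<close> also competes for \<open>c\<close>, and multiplying
  both points by q \<le> t stretches their distance at most t times.\<close>

lemma psi_lipschitz:
  assumes "1 \<le> t"
  shows "psi c t \<le> psi d t + t * cmod (c - d)"
proof -
  obtain q where q: "1 \<le> q" "real q \<le> t" "psi d t = torus_norm (of_nat q * d)"
    using psi_attained[OF assms] .
  have "psi c t \<le> torus_norm (of_nat q * c)"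
    using q psi_le by blast
  also have "\<dots> \<le> torus_norm (of_nat q * d) + cmod (of_nat q * c - of_nat q * d)"
    by (rule torus_norm_triangle)
  also have "cmod (of_nat q * c - of_nat q * d) = real q * cmod (c - d)"
    by (metis norm_mult norm_of_nat right_diff_distrib)
  also have "\<dots> \<le> t * cmod (c - d)"
    using q by (intro mult_right_mono) auto
  finally show ?thesis
    using q by simp
qed

text \<open>Transfers estimates between a rational point and the limit point. The error is quadratic
  in \<open>t\<close>, which dictates how fast the rational points have to converge later
  on.\<close>

lemma t_psi_sq_lipschitz:
  assumes "1 \<le> t"
  shows "t * (psi c t)\<^sup>2 \<le> t * (psi d t)\<^sup>2 + 2 * t\<^sup>2 * cmod (c - d)"
proof -
  have "(psi c t)\<^sup>2 - (psi d t)\<^sup>2 = (psi c t - psi d t) * (psi c t + psi d t)"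
    by (simp add: power2_eq_square algebra_simps)
  also have "\<dots> \<le> (t * cmod (c - d)) * (psi c t + psi d t)"
    using psi_lipschitz[OF assms, of c d] psi_nonneg[OF assms]
    by (intro mult_right_mono) (auto intro: add_nonneg_nonneg)
  also have "\<dots> \<le> (t * cmod (c - d)) * 2"
    using psi_le_1[OF assms, of c] psi_le_1[OF assms, of d] assms
    by (intro mult_left_mono) auto
  finally have "t * ((psi c t)\<^sup>2 - (psi d t)\<^sup>2) \<le> t * ((t * cmod (c - d)) * 2)"
    using assms by (intro mult_left_mono) auto
  then show ?thesis
    by (simp add: algebra_simps power2_eq_square)
qed

section \<open>Areas of circular caps and sectors\<close>

lemma norm_real2: "norm x = sqrt ((x $ 1)\<^sup>2 + (x $ 2)\<^sup>2)" for x :: "real ^ 2"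
  by (simp add: norm_vec_def L2_set_def sum_2)

lemma inner_real2: "x \<bullet> y = x $ 1 * y $ 1 + x $ 2 * y $ 2" for x y :: "real ^ 2"
  by (simp add: inner_vec_def sum_2)

text \<open>Both measures agree on boxes. The coordinates are swapped so that fixing the first
  component of a pair cuts a planar set along a horizontal line.\<close>

lemma lborel_real2:
  "(lborel :: (real ^ 2) measure) = distr (lborel :: (real \<times> real) measure) borel (\<lambda>p. vector [snd p, fst p])"
proof (rule lborel_eqI)
  let ?f = "\<lambda>p :: real \<times> real. vector [snd p, fst p] :: real ^ 2"
  have f: "?f = (\<lambda>p. snd p *\<^sub>R axis 1 1 + fst p *\<^sub>R axis 2 1)"
    by (auto simp: vec_eq_iff forall_2 axis_def)
  have [measurable]: "?f \<in> borel_measurable borel"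
    unfolding f by (intro borel_measurable_continuous_onI continuous_intros)
  fix l u :: "real ^ 2" assume le: "\<And>b. b \<in> Basis \<Longrightarrow> l \<bullet> b \<le> u \<bullet> b"
  then have le': "l $ i \<le> u $ i" for i
    using le[of "axis i 1"] by (simp add: inner_axis axis_in_Basis_iff)
  have "emeasure (distr lborel borel ?f) (box l u) = emeasure lborel (?f -` box l u)"
    by (subst emeasure_distr) auto
  also have "?f -` box l u = box (l $ 2, l $ 1) (u $ 2, u $ 1)"
    by (auto simp: mem_box_cart forall_2 box_prod box_real)
  also have "emeasure lborel \<dots> = ennreal ((u $ 1 - l $ 1) * (u $ 2 - l $ 2))"
    using le' by (subst emeasure_lborel_box) (auto simp: Basis_prod_def prod.union_disjoint
      prod.reindex inj_on_def mult.commute)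
  also have "(u $ 1 - l $ 1) * (u $ 2 - l $ 2) = (\<Prod>b\<in>Basis. (u - l) \<bullet> b)"
  proof -
    have "(Basis :: (real ^ 2) set) = (\<lambda>i. axis i 1) ` UNIV"
      by (auto simp: Basis_vec_def)
    then have "(\<Prod>b\<in>Basis. (u - l) \<bullet> b) = (\<Prod>b\<in>(\<lambda>i. axis i 1) ` UNIV. (u - l) \<bullet> b)"
      by (rule arg_cong)
    also have "\<dots> = (\<Prod>i\<in>UNIV. (u - l) \<bullet> axis i 1)"
      by (subst prod.reindex) (auto simp: inj_on_def axis_eq_axis)
    finally have "(\<Prod>b\<in>Basis. (u - l) \<bullet> b) = (\<Prod>i\<in>UNIV. (u - l) \<bullet> axis i 1)" .
    then show ?thesis
      by (simp add: inner_axis UNIV_2)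
  qed
  finally show "emeasure (distr lborel borel ?f) (box l u) = (\<Prod>b\<in>Basis. (u - l) \<bullet> b)" .
qed simp

lemma emeasure_real2_slices:
  fixes S :: "(real ^ 2) set"
  assumes S: "S \<in> sets borel"
  shows "emeasure lborel S = (\<integral>\<^sup>+ y. emeasure lborel {x. vector [x, y] \<in> S} \<partial>lborel)"
proof -
  let ?f = "\<lambda>p :: real \<times> real. vector [snd p, fst p] :: real ^ 2"
  have f: "?f = (\<lambda>p. snd p *\<^sub>R axis 1 1 + fst p *\<^sub>R axis 2 1)"
    by (auto simp: vec_eq_iff forall_2 axis_def)
  have [measurable]: "?f \<in> borel_measurable borel"
    unfolding f by (intro borel_measurable_continuous_onI continuous_intros)
  have "?f -` S \<in> sets borel"
    using measurable_sets[of ?f borel borel S] S by simp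
  then have M: "?f -` S \<in> sets (lborel \<Otimes>\<^sub>M lborel)"
    by (simp only: lborel_prod sets_lborel)
  have "emeasure lborel S = emeasure lborel (?f -` S)"
    using S by (subst lborel_real2, subst emeasure_distr) auto
  also have "\<dots> = emeasure (lborel \<Otimes>\<^sub>M lborel) (?f -` S)"
    by (simp add: lborel_prod)
  also have "\<dots> = (\<integral>\<^sup>+ y. emeasure lborel (Pair y -` (?f -` S)) \<partial>lborel)"
    by (rule lborel.emeasure_pair_measure_alt[OF M])
  finally show ?thesis
    by (simp add: vimage_def)
qed

text \<open>The function \<open>g\<close> gives the slice lengths only strictly between
  \<open>a\<close> and \<open>b\<close>; elsewhere it may be negative, as happens for the circle
  functions below.\<close>

lemma measure_real2_slices:
  fixes S :: "(real ^ 2) set" and g :: "real \<Rightarrow> real"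
  assumes S: "S \<in> sets borel" and cont: "continuous_on UNIV g"
    and slice: "\<And>y. a < y \<Longrightarrow> y < b \<Longrightarrow> 0 \<le> g y \<and> emeasure lborel {x. vector [x, y] \<in> S} = ennreal (g y)"
    and empty: "\<And>y x. y \<le> a \<or> b \<le> y \<Longrightarrow> vector [x, y] \<notin> S"
    and I: "(g has_integral I) {a..b}"
  shows "measure lborel S = I"
proof -
  define G where "G = (\<lambda>y. if y \<in> {a<..<b} then g y else 0)"
  have "(G has_integral I) UNIV"
    unfolding G_def using I by (simp only: has_integral_restrict_UNIV has_integral_Icc_iff_Ioo)
  moreover have "G \<in> borel_measurable borel"
  proof -
    have [measurable]: "g \<in> borel_measurable borel"
      by (rule borel_measurable_continuous_onI[OF cont])
    show ?thesis
      unfolding G_def by measurable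
  qed
  moreover have "0 \<le> G y" for y
    using slice[of y] by (auto simp: G_def)
  ultimately have "integral\<^sup>N lborel G = ennreal I"
    by (intro nn_integral_has_integral_lborel)
  moreover have "emeasure lborel S = integral\<^sup>N lborel G"
    unfolding emeasure_real2_slices[OF S]
  proof (rule nn_integral_cong)
    fix y
    show "emeasure lborel {x. vector [x, y] \<in> S} = ennreal (G y)"
      using slice[of y] empty[of y] by (cases "a < y \<and> y < b") (auto simp: G_def not_less)
  qed
  moreover have "0 \<le> I"
    using I unfolding has_integral_Icc_iff_Ioo by (rule has_integral_nonneg) (use slice in auto)
  ultimately show ?thesis
    by (simp add: measure_def)
qed

text \<open>The concave sine lies above its chord from 0 to \<open>pi / 3\<close>. Equality at
  \<open>\<alpha> = pi / 6\<close> corresponds to neighbours at distance \<open>sqrt 3\<close>, the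
  hexagonal case.\<close>

lemma sin_double_ge_linear:
  assumes "0 \<le> \<alpha>" "\<alpha> \<le> pi / 6"
  shows "3 * sqrt 3 / pi * \<alpha> \<le> sin (2 * \<alpha>)"
proof -
  have "concave_on {0..pi} sin"
  proof (rule f''_le0_imp_concave)
    show "convex {0..pi}" by simp
    show "(sin has_real_derivative cos x) (at x)" for x by (rule DERIV_sin)
    show "(cos has_real_derivative - sin x) (at x)" for x by (rule DERIV_cos)
    show "- sin x \<le> 0" if "x \<in> {0..pi}" for x
      using that sin_ge_zero[of x] by simp
  qed
  then have "(1 - 6 * \<alpha> / pi) * sin 0 + (6 * \<alpha> / pi) * sin (pi / 3)
      \<le> sin ((1 - 6 * \<alpha> / pi) *\<^sub>R 0 + (6 * \<alpha> / pi) *\<^sub>R (pi / 3))"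
    using assms by (intro concave_onD[of "{0..pi}" sin]) (auto simp: field_simps)
  then show ?thesis
    by (simp add: sin_60 field_simps)
qed

text \<open>What the perpendicular bisector of 0 and \<open>q\<close> cuts off from the open unit
  disc: the points that are not closer to 0 than to \<open>q\<close>.\<close>

definition cap :: "real ^ 2 \<Rightarrow> (real ^ 2) set" where
  "cap q = {x. norm x < 1 \<and> (norm q)\<^sup>2 \<le> 2 * (x \<bullet> q)}"

text \<open>For \<open>0 < norm q < 2\<close> this is the circular sector over the chord that bounds
  \<open>cap q\<close>. The second condition says that the unit vector along \<open>x\<close> has
  distance less than 1 from \<open>q\<close>.\<close>

definition sector :: "real ^ 2 \<Rightarrow> (real ^ 2) set" where
  "sector q = {x. norm x < 1 \<and> norm x * (norm q)\<^sup>2 < 2 * (x \<bullet> q)}"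

lemma cap_borel: "cap q \<in> sets borel"
proof -
  have "cap q = ball 0 1 \<inter> {x. (norm q)\<^sup>2 \<le> 2 * (x \<bullet> q)}"
    by (auto simp: cap_def)
  moreover have "closed {x. (norm q)\<^sup>2 \<le> 2 * (x \<bullet> q)}"
    by (intro closed_Collect_le continuous_intros)
  ultimately show ?thesis
    by simp
qed

lemma open_sector: "open (sector q)"
proof -
  have "sector q = ball 0 1 \<inter> {x. norm x * (norm q)\<^sup>2 < 2 * (x \<bullet> q)}"
    by (auto simp: sector_def)
  moreover have "open {x. norm x * (norm q)\<^sup>2 < 2 * (x \<bullet> q)}"
    by (intro open_Collect_less continuous_intros)
  ultimately show ?thesis
    by auto
qed

section \<open>Areas of a cap and a sector centred on the first axis\<close>

lemma has_integral_sqrt: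
  fixes s d :: real
  assumes "0 \<le> s" "s \<le> 1" "d = sqrt (1 - s\<^sup>2)"
  shows "((\<lambda>y. sqrt (1 - y\<^sup>2)) has_integral (s * d + arcsin s)) {- s..s}"
proof -
  define F where "F = (\<lambda>y::real. (y * sqrt (1 - y\<^sup>2) + arcsin y) / 2)"
  have "((\<lambda>y. sqrt (1 - y\<^sup>2)) has_integral (F s - F (- s))) {- s..s}"
  \<comment> \<open>Differentiability is asked only in the interior: for \<open>s = 1\<close> the
    square root and the arcsine are not differentiable at the end points.\<close>
  proof (rule fundamental_theorem_of_calculus_interior)
    show "- s \<le> s" using assms by simp
    show "continuous_on {- s..s} F"
      unfolding F_def using assms by (intro continuous_intros) auto
    fix y assume y: "y \<in> {- s<..<s}"
    then have y1: "\<bar>y\<bar> < 1" using assms by auto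
    then have y2: "1 - y\<^sup>2 > 0"
      by (simp add: abs_square_less_1)
    have "(F has_real_derivative (sqrt (1 - y\<^sup>2) + y * (- 2 * y / (2 * sqrt (1 - y\<^sup>2))) + inverse (sqrt (1 - y\<^sup>2))) / 2) (at y)"
      unfolding F_def using y1 y2
      by (auto intro!: derivative_eq_intros simp: divide_simps)
    also have "(sqrt (1 - y\<^sup>2) + y * (- 2 * y / (2 * sqrt (1 - y\<^sup>2))) + inverse (sqrt (1 - y\<^sup>2))) / 2 = sqrt (1 - y\<^sup>2)"
      using y2 real_sqrt_pow2[of "1 - y\<^sup>2"] by (simp add: field_simps power2_eq_square)
    finally show "(F has_vector_derivative sqrt (1 - y\<^sup>2)) (at y)"
      by (simp add: has_real_derivative_iff_has_vector_derivative)
  qed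
  moreover have "F s - F (- s) = s * d + arcsin s"
    using assms by (simp add: F_def arcsin_minus field_simps)
  ultimately show ?thesis
    by simp
qed

lemma has_integral_abs:
  fixes s :: real
  assumes "0 \<le> s"
  shows "((\<lambda>y. \<bar>y\<bar>) has_integral s\<^sup>2) {- s..s}"
proof -
  have "((\<lambda>y. \<bar>y\<bar>) has_integral s\<^sup>2 / 2) {- s..0}"
  proof (rule has_integral_eq)
    have "((\<lambda>y. - y) has_integral - ((0\<^sup>2 - (- s)\<^sup>2) / 2)) {- s..0}"
      using assms by (intro has_integral_neg ident_has_integral) auto
    then show "((\<lambda>y. - y) has_integral s\<^sup>2 / 2) {- s..0}"
      by simp
  qed auto
  moreover have "((\<lambda>y. \<bar>y\<bar>) has_integral s\<^sup>2 / 2) {0..s}"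
  proof (rule has_integral_eq)
    show "((\<lambda>y. y) has_integral s\<^sup>2 / 2) {0..s}"
      using ident_has_integral[OF assms] by simp
  qed auto
  ultimately show ?thesis
    using has_integral_combine[of "- s" 0 s "\<lambda>y. \<bar>y\<bar>" "s\<^sup>2 / 2" "s\<^sup>2 / 2"] assms by simp
qed

lemma sq_less_iff_less_sqrt: "0 \<le> x \<Longrightarrow> x\<^sup>2 + y\<^sup>2 < 1 \<longleftrightarrow> x < sqrt (1 - y\<^sup>2)" for x y :: real
  by (metis abs_of_nonneg add.commute less_diff_eq real_sqrt_abs real_sqrt_less_iff add_diff_eq diff_less_eq less_diff_eq)

text \<open>The area is that of a sector with half-angle \<open>arcsin s\<close> minus a triangle of
  base \<open>2 * s\<close> and height \<open>d\<close>; it comes out by integrating the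
  slices.\<close>

lemma measure_cap_axis:
  fixes d :: real
  assumes d: "0 < d" "d < 1" and s: "s = sqrt (1 - d\<^sup>2)"
  shows "measure lborel (cap (vector [2 * d, 0])) = arcsin s - s * d"
proof (rule measure_real2_slices[OF cap_borel])
  have d2: "d\<^sup>2 < 1"
    using d by (simp add: abs_square_less_1)
  have s0: "0 < s" "s \<le> 1" and s2: "s\<^sup>2 = 1 - d\<^sup>2"
    using d2 by (auto simp: s)
  then have ds: "d = sqrt (1 - s\<^sup>2)"
    using d by simp
  have mem: "vector [x, y] \<in> cap (vector [2 * d, 0]) \<longleftrightarrow> d \<le> x \<and> x < sqrt (1 - y\<^sup>2)" for x y
  proof -
    have "vector [x, y] \<in> cap (vector [2 * d, 0]) \<longleftrightarrow> d \<le> x \<and> x\<^sup>2 + y\<^sup>2 < 1"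
      using d by (auto simp: cap_def norm_real2 inner_real2 power2_eq_square)
    then show ?thesis
      using sq_less_iff_less_sqrt[of x y] d by auto
  qed
  show "continuous_on UNIV (\<lambda>y. sqrt (1 - y\<^sup>2) - d)"
    by (intro continuous_intros)
  show "((\<lambda>y. sqrt (1 - y\<^sup>2) - d) has_integral (arcsin s - s * d)) {- s..s}"
  proof -
    have "((\<lambda>y. sqrt (1 - y\<^sup>2) - d) has_integral ((s * d + arcsin s) - (s - (- s)) *\<^sub>R d)) {- s..s}"
      by (intro has_integral_diff has_integral_sqrt has_integral_const_real)
        (use s0 ds has_integral_const_real[of d "- s" s] in auto)
    then show ?thesis
      by (simp add: algebra_simps)
  qed
  fix y :: real
  have lt: "d < sqrt (1 - y\<^sup>2) \<longleftrightarrow> \<bar>y\<bar> < s"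
  proof -
    have "d < sqrt (1 - y\<^sup>2) \<longleftrightarrow> d\<^sup>2 + y\<^sup>2 < 1"
      using sq_less_iff_less_sqrt[of d y] d by simp
    also have "\<dots> \<longleftrightarrow> \<bar>y\<bar>\<^sup>2 + d\<^sup>2 < 1"
      by (simp add: add.commute)
    also have "\<dots> \<longleftrightarrow> \<bar>y\<bar> < s"
      unfolding s by (rule sq_less_iff_less_sqrt) simp
    finally show ?thesis .
  qed
  show "0 \<le> sqrt (1 - y\<^sup>2) - d \<and> emeasure lborel {x. vector [x, y] \<in> cap (vector [2 * d, 0])} = ennreal (sqrt (1 - y\<^sup>2) - d)"
    if "- s < y" "y < s"
  proof -
    have "d < sqrt (1 - y\<^sup>2)" using lt that by auto
    moreover have "{x. vector [x, y] \<in> cap (vector [2 * d, 0])} = {d..<sqrt (1 - y\<^sup>2)}"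
      by (auto simp: mem)
    ultimately show ?thesis
      by simp
  qed
  show "vector [x, y] \<notin> cap (vector [2 * d, 0])" if "y \<le> - s \<or> s \<le> y" for x
    using lt that unfolding mem by auto
qed

text \<open>A horizontal slice runs from the bounding ray of the sector to the unit circle.
  Integrating the ray gives \<open>s * d\<close>, which cancels the same term in
  \<open>has_integral_sqrt\<close>.\<close>

lemma measure_sector_axis:
  fixes d :: real
  assumes d: "0 < d" "d < 1" and s: "s = sqrt (1 - d\<^sup>2)"
  shows "measure lborel (sector (vector [2 * d, 0])) = arcsin s"
proof (rule measure_real2_slices)
  show "sector (vector [2 * d, 0]) \<in> sets borel"
    using open_sector by auto
  have d2: "d\<^sup>2 < 1"
    using d by (simp add: abs_square_less_1)
  have s0: "0 < s" "s \<le> 1" and s2: "s\<^sup>2 = 1 - d\<^sup>2"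
    using d2 by (auto simp: s)
  then have ds: "d = sqrt (1 - s\<^sup>2)"
    using d by simp
  have mem: "vector [x, y] \<in> sector (vector [2 * d, 0]) \<longleftrightarrow> \<bar>y\<bar> * d / s < x \<and> x < sqrt (1 - y\<^sup>2)" for x y
  proof -
    have "vector [x, y] \<in> sector (vector [2 * d, 0]) \<longleftrightarrow> sqrt (x\<^sup>2 + y\<^sup>2) * d < x \<and> x\<^sup>2 + y\<^sup>2 < 1"
      using d by (auto simp: sector_def norm_real2 inner_real2 power2_eq_square)
    also have "sqrt (x\<^sup>2 + y\<^sup>2) * d < x \<longleftrightarrow> \<bar>y\<bar> * d / s < x"
    proof (cases "0 \<le> x")
      case True
      have "sqrt (x\<^sup>2 + y\<^sup>2) * d < x \<longleftrightarrow> (sqrt (x\<^sup>2 + y\<^sup>2) * d)\<^sup>2 < x\<^sup>2"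
        using True d by (intro iffI power_strict_mono) (auto intro: power2_less_imp_less)
      also have "\<dots> \<longleftrightarrow> (x\<^sup>2 + y\<^sup>2) * d\<^sup>2 < x\<^sup>2"
        by (simp add: power_mult_distrib)
      also have "\<dots> \<longleftrightarrow> y\<^sup>2 * d\<^sup>2 < x\<^sup>2 * s\<^sup>2"
        unfolding s2 by (simp add: algebra_simps)
      also have "\<dots> \<longleftrightarrow> (\<bar>y\<bar> * d)\<^sup>2 < (x * s)\<^sup>2"
        by (simp add: power_mult_distrib)
      also have "\<dots> \<longleftrightarrow> \<bar>y\<bar> * d < x * s"
        using True d s0 by (intro iffI power_strict_mono) (auto intro: power2_less_imp_less)
      finally show ?thesis
        using s0 by (simp add: field_simps)
    next
      case False
      moreover have "0 \<le> sqrt (x\<^sup>2 + y\<^sup>2) * d" "0 \<le> \<bar>y\<bar> * d / s"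
        using d s0 by auto
      ultimately show ?thesis
        by linarith
    qed
    also have "\<bar>y\<bar> * d / s < x \<and> x\<^sup>2 + y\<^sup>2 < 1 \<longleftrightarrow> \<bar>y\<bar> * d / s < x \<and> x < sqrt (1 - y\<^sup>2)"
    proof -
      have "0 \<le> \<bar>y\<bar> * d / s"
        using d s0 by auto
      then show ?thesis
        using sq_less_iff_less_sqrt[of x y] by (smt (verit))
    qed
    finally show ?thesis .
  qed
  show "continuous_on UNIV (\<lambda>y. sqrt (1 - y\<^sup>2) - \<bar>y\<bar> * (d / s))"
    by (intro continuous_intros)
  show "((\<lambda>y. sqrt (1 - y\<^sup>2) - \<bar>y\<bar> * (d / s)) has_integral arcsin s) {- s..s}"
  proof -
    have "((\<lambda>y. sqrt (1 - y\<^sup>2) - \<bar>y\<bar> * (d / s)) has_integral ((s * d + arcsin s) - s\<^sup>2 * (d / s))) {- s..s}"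
      by (intro has_integral_diff has_integral_sqrt has_integral_mult_left has_integral_abs) (use s0 ds in auto)
    then show ?thesis
      using s0 by (simp add: power2_eq_square)
  qed
  fix y :: real
  have lt: "\<bar>y\<bar> * d / s < sqrt (1 - y\<^sup>2) \<longleftrightarrow> \<bar>y\<bar> < s"
  proof -
    have "\<bar>y\<bar> * d / s < sqrt (1 - y\<^sup>2) \<longleftrightarrow> (\<bar>y\<bar> * d / s)\<^sup>2 + y\<^sup>2 < 1"
      using sq_less_iff_less_sqrt[of "\<bar>y\<bar> * d / s" y] d s0 by simp
    also have "(\<bar>y\<bar> * d / s)\<^sup>2 + y\<^sup>2 = y\<^sup>2 / s\<^sup>2"
    proof -
      have "(\<bar>y\<bar> * d / s)\<^sup>2 + y\<^sup>2 = (y\<^sup>2 * d\<^sup>2 + y\<^sup>2 * s\<^sup>2) / s\<^sup>2"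
        using s0 by (simp add: power_mult_distrib power_divide add_divide_distrib)
      also have "y\<^sup>2 * d\<^sup>2 + y\<^sup>2 * s\<^sup>2 = y\<^sup>2"
        unfolding s2 by (simp add: algebra_simps)
      finally show ?thesis .
    qed
    also have "y\<^sup>2 / s\<^sup>2 < 1 \<longleftrightarrow> \<bar>y\<bar> < s"
    proof -
      have "y\<^sup>2 / s\<^sup>2 < 1 \<longleftrightarrow> \<bar>y\<bar>\<^sup>2 < s\<^sup>2"
        using s0 by (simp add: field_simps)
      also have "\<dots> \<longleftrightarrow> \<bar>y\<bar> < s"
        using s0 by (intro iffI power_strict_mono) (auto intro: power2_less_imp_less)
      finally show ?thesis .
    qed
    finally show ?thesis .
  qed
  show "0 \<le> sqrt (1 - y\<^sup>2) - \<bar>y\<bar> * (d / s) \<and>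
      emeasure lborel {x. vector [x, y] \<in> sector (vector [2 * d, 0])} = ennreal (sqrt (1 - y\<^sup>2) - \<bar>y\<bar> * (d / s))"
    if "- s < y" "y < s"
  proof -
    have "\<bar>y\<bar> * d / s < sqrt (1 - y\<^sup>2)" using lt that by auto
    moreover have "{x. vector [x, y] \<in> sector (vector [2 * d, 0])} = {\<bar>y\<bar> * d / s<..<sqrt (1 - y\<^sup>2)}"
      by (auto simp: mem)
    ultimately show ?thesis
      by simp
  qed
  show "vector [x, y] \<notin> sector (vector [2 * d, 0])" if "y \<le> - s \<or> s \<le> y" for x
    using lt that unfolding mem by auto
qed

lemma image_cap_sector:
  assumes "orthogonal_transformation f"
  shows "f ` cap q = cap (f q)" "f ` sector q = sector (f q)"
proof -
  have n: "norm (f x) = norm x" and i: "f x \<bullet> f y = x \<bullet> y" for x y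
    using assms by (auto simp: orthogonal_transformation_def orthogonal_transformation_norm[OF assms])
  have "surj f"
    using assms orthogonal_transformation_surj by blast
  then have r: "\<exists>y. x = f y" for x by blast
  show "f ` cap q = cap (f q)"
  proof (intro equalityI subsetI)
    fix x assume "x \<in> cap (f q)"
    moreover obtain y where "x = f y" using r by blast
    ultimately show "x \<in> f ` cap q" by (auto simp: cap_def n i)
  qed (auto simp: cap_def n i)
  show "f ` sector q = sector (f q)"
  proof (intro equalityI subsetI)
    fix x assume "x \<in> sector (f q)"
    moreover obtain y where "x = f y" using r by blast
    ultimately show "x \<in> f ` sector q" by (auto simp: sector_def n i)
  qed (auto simp: sector_def n i)
qed

lemma cap_lmeasurable: "cap q \<in> lmeasurable"
proof (rule bounded_set_imp_lmeasurable)
  show "bounded (cap q)"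
    by (rule bounded_subset[OF bounded_ball[of 0 1]]) (auto simp: cap_def)
qed (simp add: cap_borel)

lemma sector_lmeasurable: "sector q \<in> lmeasurable"
proof (rule bounded_set_imp_lmeasurable)
  show "bounded (sector q)"
    by (rule bounded_subset[OF bounded_ball[of 0 1]]) (auto simp: sector_def)
qed (simp add: open_sector borel_open)

text \<open>Rotate \<open>q\<close> to the first axis and let \<alpha> be the half-angle of the
  sector. The sector has area \<alpha> and the cap \<alpha> - sin (2 \<alpha>) / 2, so
  \<open>sin_double_ge_linear\<close> bounds the ratio by its value at
  \<open>norm q = sqrt 3\<close>.\<close>

lemma measure_cap_le_sector:
  fixes q :: "real ^ 2"
  assumes q: "sqrt 3 \<le> norm q" "norm q < 2"
  shows "measure lborel (cap q) \<le> (1 - 3 * sqrt 3 / (2 * pi)) * measure lborel (sector q)"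
proof -
  define d where "d = norm q / 2"
  define s where "s = sqrt (1 - d\<^sup>2)"
  define p :: "real ^ 2" where "p = vector [2 * d, 0]"
  have d: "sqrt 3 / 2 \<le> d" "d < 1" "0 < d"
    using q by (auto simp: d_def intro: less_le_trans[of 0 "sqrt 3"])
  have "norm p = norm q"
    using d by (simp add: p_def norm_real2 d_def)
  then obtain f where f: "orthogonal_transformation f" "f p = q"
    using orthogonal_transformation_exists by blast
  have cap: "measure lborel (cap q) = measure lborel (cap p)"
    using measure_orthogonal_image[OF f(1) cap_lmeasurable, of p]
    by (simp add: image_cap_sector[OF f(1)] f(2) cap_borel)
  have sec: "measure lborel (sector q) = measure lborel (sector p)"
    using measure_orthogonal_image[OF f(1) sector_lmeasurable, of p]
    by (simp add: image_cap_sector[OF f(1)] f(2) open_sector borel_open)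
  define \<alpha> where "\<alpha> = arcsin s"
  have "(sqrt 3 / 2)\<^sup>2 \<le> d\<^sup>2"
    using d by (intro power_mono) auto
  then have "1 - d\<^sup>2 \<le> (1/2)\<^sup>2"
    by (simp add: power_divide)
  then have "s \<le> 1 / 2"
    unfolding s_def by (intro real_le_lsqrt) auto
  have d2: "d\<^sup>2 < 1"
    using d by (simp add: abs_square_less_1)
  then have s0: "0 < s" and s2: "s\<^sup>2 = 1 - d\<^sup>2" by (auto simp: s_def)
  have "arcsin (1/2) = pi / 6"
    using arcsin_sin[of "pi / 6"] by (simp add: sin_30)
  then have \<alpha>: "0 \<le> \<alpha>" "\<alpha> \<le> pi / 6"
    using s0 \<open>s \<le> 1/2\<close> arcsin_le_mono[of s "1/2"] arcsin_le_mono[of 0 s] by (auto simp: \<alpha>_def)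
  have "sin \<alpha> = s" "cos \<alpha> = d"
    using s0 \<open>s \<le> 1/2\<close> d cos_arcsin[of s] by (auto simp: \<alpha>_def s2)
  then have "3 * sqrt 3 / pi * \<alpha> \<le> 2 * s * d"
    using sin_double_ge_linear[OF \<alpha>] by (simp add: sin_double)
  then have "\<alpha> - s * d \<le> (1 - 3 * sqrt 3 / (2 * pi)) * \<alpha>"
    by (simp add: field_simps)
  then show ?thesis
    unfolding cap sec p_def using measure_cap_axis[OF d(3,2) s_def] measure_sector_axis[OF d(3,2) s_def]
    by (simp add: \<alpha>_def)
qed

text \<open>A common direction yields a unit vector \<open>y\<close> at distance 1 from the origin
  and less than 1 from \<open>p\<close> and \<open>q\<close>. Three points with mutual distances at
  least \<open>sqrt 3\<close> cannot lie like that.\<close>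

lemma sector_disjoint:
  assumes "sqrt 3 \<le> norm p" "sqrt 3 \<le> norm q" "sqrt 3 \<le> norm (p - q)"
  shows "sector p \<inter> sector q = {}"
proof (rule ccontr)
  assume "sector p \<inter> sector q \<noteq> {}"
  then obtain x where x: "x \<in> sector p" "x \<in> sector q"
    by auto
  have x0: "x \<noteq> 0"
    using x by (auto simp: sector_def)
  define y where "y = x /\<^sub>R norm x"
  have y1: "norm y = 1"
    using x0 by (simp add: y_def)
  have in_ball: "(norm (r - y))\<^sup>2 < 1" if "x \<in> sector r" for r
  proof -
    have "(norm r)\<^sup>2 < 2 * (x \<bullet> r) / norm x"
      using that x0 by (simp add: sector_def field_simps)
    then have "(norm r)\<^sup>2 < 2 * (y \<bullet> r)"
      by (simp add: y_def divide_inverse mult.commute)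
    then show ?thesis
      using y1 by (simp add: power2_norm_eq_inner inner_diff_left inner_diff_right inner_commute norm_eq_1)
  qed
  have sq: "3 \<le> (norm z)\<^sup>2" if "sqrt 3 \<le> norm z" for z :: "real ^ 2"
    using power_mono[OF that, of 2] by simp
  \<comment> \<open>The variance identity for 0, \<open>p\<close>, \<open>q\<close> about
    \<open>y\<close>: the squared mutual distances sum to at least 9, while the right-hand side is
    below 9.\<close>
  have "(norm p)\<^sup>2 + (norm q)\<^sup>2 + (norm (p - q))\<^sup>2 + (norm (p + q - 3 *\<^sub>R y))\<^sup>2
      = 3 * ((norm (p - y))\<^sup>2 + (norm (q - y))\<^sup>2 + (norm y)\<^sup>2)"
    by (simp add: power2_norm_eq_inner inner_diff_left inner_diff_right inner_add_left inner_add_right inner_commute)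
  moreover have "0 \<le> (norm (p + q - 3 *\<^sub>R y))\<^sup>2"
    by simp
  ultimately show False
    using in_ball[OF x(1)] in_ball[OF x(2)] y1 sq[OF assms(1)] sq[OF assms(2)] sq[OF assms(3)] by simp
qed

section \<open>Packings of the plane\<close>

definition cell :: "(real ^ 2) set \<Rightarrow> real ^ 2 \<Rightarrow> (real ^ 2) set" where
  "cell P p = {x. dist x p < 1 \<and> (\<forall>q\<in>P - {p}. dist x p < dist x q)}"

text \<open>Truncating the Voronoi cell at radius \<open>1\<close>, the circumradius of an equilateral triangle of side
  \<open>sqrt 3\<close>, makes the sectors over the removed caps disjoint, so the caps cannot take more than the
  fraction of the disc that they take in the hexagonal packing.\<close>

lemma cell_lmeasurable:
  assumes "finite P"
  shows "cell P p \<in> lmeasurable"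
proof (rule lmeasurable_open)
  show "bounded (cell P p)"
    by (rule bounded_subset[OF bounded_ball[of p 1]]) (auto simp: cell_def dist_commute)
  have "cell P p = ball p 1 \<inter> (\<Inter>q\<in>P - {p}. {x. dist x p < dist x q})"
    by (auto simp: cell_def dist_commute)
  moreover have "open {x. dist x p < dist x q}" for q
    by (intro open_Collect_less continuous_intros)
  ultimately show "open (cell P p)"
    using assms by (auto intro!: open_Int open_INT)
qed

lemma cell_disjoint: "p \<in> P \<Longrightarrow> q \<in> P \<Longrightarrow> p \<noteq> q \<Longrightarrow> cell P p \<inter> cell P q = {}"
  by (fastforce simp: cell_def dest: bspec)

text \<open>Only neighbours at distance below 2 cut into the unit disc, each by a cap. Their sectors
  are disjoint, so the caps take at most the fraction \<kappa> of the disc. What remains is the area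
  of the regular hexagon of inradius \<open>sqrt 3 / 2\<close>.\<close>

lemma measure_cell_ge:
  assumes fin: "finite P" and p: "p \<in> P"
    and sep: "\<And>x y. x \<in> P \<Longrightarrow> y \<in> P \<Longrightarrow> x \<noteq> y \<Longrightarrow> sqrt 3 \<le> dist x y"
  shows "3 * sqrt 3 / 2 \<le> measure lebesgue (cell P p)"
proof -
  define \<kappa> where "\<kappa> = 1 - 3 * sqrt 3 / (2 * pi)"
  define S where "S = {q - p | q. q \<in> P - {p} \<and> dist q p < 2}"
  have finS: "finite S"
    using fin by (simp add: S_def)
  have Sn: "sqrt 3 \<le> norm q" "norm q < 2" if "q \<in> S" for q
    using that sep p by (auto simp: S_def dist_norm)
  have sepS: "sqrt 3 \<le> norm (q - q')" if "q \<in> S" "q' \<in> S" "q \<noteq> q'" for q q'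
    using that sep by (auto simp: S_def dist_norm)
  have capm: "measure lebesgue (cap q) \<le> \<kappa> * measure lebesgue (sector q)" if "q \<in> S" for q
    using measure_cap_le_sector[OF Sn[OF that]]
    by (simp add: \<kappa>_def cap_borel open_sector borel_open)
  have \<kappa>: "0 \<le> \<kappa>"
  proof -
    have "sqrt 3 * 3 \<le> 2 * pi"
    proof -
      have "sqrt 3 \<le> 2" by (rule real_le_lsqrt) auto
      then show ?thesis using pi_gt3 by simp
    qed
    then show ?thesis by (simp add: \<kappa>_def field_simps)
  qed
  have "measure lebesgue (\<Union>q\<in>S. sector q) \<le> measure lebesgue (ball 0 1 :: (real ^ 2) set)"
    by (rule measure_mono_fmeasurable)
      (use finS sector_lmeasurable in \<open>auto simp: sector_def intro!: sets.finite_UN fmeasurableD\<close>)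
  moreover have "measure lebesgue (\<Union>q\<in>S. sector q) = (\<Sum>q\<in>S. measure lebesgue (sector q))"
  proof (rule measure_UNION')
    show "pairwise (\<lambda>q q'. disjnt (sector q) (sector q')) S"
      unfolding pairwise_def disjnt_def
      using sector_disjoint Sn(1) sepS by blast
  qed (use finS sector_lmeasurable in auto)
  ultimately have sectors: "(\<Sum>q\<in>S. measure lebesgue (sector q)) \<le> pi"
    using circle_area[of 1 "0 :: real ^ 2"] by simp
  have "(+) p ` (ball 0 1 - (\<Union>q\<in>S. cap q)) \<subseteq> cell P p"
  proof safe
    fix x assume x: "x \<in> ball 0 1" "x \<notin> (\<Union>q\<in>S. cap q)"
    have "dist (p + x) p < dist (p + x) q" if q: "q \<in> P" "q \<noteq> p" for q
    proof (cases "dist q p < 2")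
      case True
      then have "q - p \<in> S"
        using q by (auto simp: S_def)
      then have "2 * (x \<bullet> (q - p)) < (norm (q - p))\<^sup>2"
        using x by (auto simp: cap_def not_le)
      then have "(norm x)\<^sup>2 < (norm (x - (q - p)))\<^sup>2"
        by (simp add: power2_norm_eq_inner inner_diff_left inner_diff_right inner_commute)
      then have "norm x < norm (x - (q - p))"
        by (simp add: power2_less_imp_less)
      then show ?thesis
        by (simp add: dist_norm algebra_simps)
    next
      \<comment> \<open>A point of \<open>P\<close> at distance at least 2 from \<open>p\<close> is
        farther than 1 from \<open>p + x\<close>, because \<open>norm x < 1\<close>.\<close>
      case False
      have "dist q p \<le> dist (p + x) q + norm x"
        using dist_triangle[of q p "p + x"] by (simp add: dist_commute dist_norm)
      then show ?thesis
        using False x by (simp add: dist_norm)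
    qed
    then show "p + x \<in> cell P p"
      using x by (auto simp: cell_def dist_norm)
  qed
  then have "measure lebesgue ((+) p ` (ball 0 1 - (\<Union>q\<in>S. cap q))) \<le> measure lebesgue (cell P p)"
    by (rule measure_mono_fmeasurable)
      (use finS cap_lmeasurable cell_lmeasurable[OF fin] in
        \<open>auto intro!: measurable_translation fmeasurableD fmeasurable.Diff fmeasurable.finite_UN sets.finite_UN\<close>)
  also have "measure lebesgue ((+) p ` (ball 0 1 - (\<Union>q\<in>S. cap q))) = measure lebesgue (ball 0 1 - (\<Union>q\<in>S. cap q))"
    by (rule measure_translation)
  also have "\<dots> = measure lebesgue (ball 0 1 :: (real ^ 2) set) - measure lebesgue (\<Union>q\<in>S. cap q)"
    using finS cap_lmeasurable
    by (intro measurable_measure_Diff) (auto simp: cap_def intro!: fmeasurableD sets.finite_UN)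
  finally have "pi - measure lebesgue (\<Union>q\<in>S. cap q) \<le> measure lebesgue (cell P p)"
    using circle_area[of 1 "0 :: real ^ 2"] by simp
  moreover have "measure lebesgue (\<Union>q\<in>S. cap q) \<le> (\<Sum>q\<in>S. measure lebesgue (cap q))"
    by (rule measure_UNION_le) (use finS cap_lmeasurable in \<open>auto intro: fmeasurableD\<close>)
  moreover have "\<dots> \<le> (\<Sum>q\<in>S. \<kappa> * measure lebesgue (sector q))"
    by (rule sum_mono) (rule capm)
  moreover have "\<dots> \<le> \<kappa> * pi"
    unfolding sum_distrib_left[symmetric] using sectors \<kappa> by (rule mult_left_mono)
  moreover have "\<kappa> * pi = pi - 3 * sqrt 3 / 2"
    by (simp add: \<kappa>_def field_simps)
  ultimately show ?thesis
    by linarith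
qed

lemma planar_packing_bound:
  fixes P :: "(real ^ 2) set"
  assumes fin: "finite P"
    and sep: "\<And>x y. x \<in> P \<Longrightarrow> y \<in> P \<Longrightarrow> x \<noteq> y \<Longrightarrow> sqrt 3 \<le> dist x y"
    and box: "\<And>p. p \<in> P \<Longrightarrow> ball p 1 \<subseteq> cbox a b"
  shows "real (card P) * (3 * sqrt 3 / 2) \<le> measure lebesgue (cbox a b)"
proof -
  have "real (card P) * (3 * sqrt 3 / 2) = (\<Sum>p\<in>P. 3 * sqrt 3 / 2)"
    by simp
  also have "\<dots> \<le> (\<Sum>p\<in>P. measure lebesgue (cell P p))"
    by (intro sum_mono measure_cell_ge fin sep)
  also have "\<dots> = measure lebesgue (\<Union>p\<in>P. cell P p)"
    by (rule measure_UNION'[symmetric])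
      (use fin cell_lmeasurable[OF fin] cell_disjoint in \<open>auto simp: pairwise_def disjnt_def\<close>)
  also have "\<dots> \<le> measure lebesgue (cbox a b)"
  proof (rule measure_mono_fmeasurable)
    show "(\<Union>p\<in>P. cell P p) \<subseteq> cbox a b"
      using box by (force simp: cell_def dist_commute)
  qed (use fin cell_lmeasurable[OF fin] in \<open>auto intro!: sets.finite_UN fmeasurableD\<close>)
  finally show ?thesis .
qed

section \<open>The upper bound\<close>

lemma cmod_gauss_int_ge_1:
  assumes "g \<in> gauss_ints" "g \<noteq> 0"
  shows "1 \<le> cmod g"
proof -
  obtain m n where g: "g = Complex (of_int m) (of_int n)"
    using assms by (auto simp: gauss_ints_def)
  then have "m \<noteq> 0 \<or> n \<noteq> 0"
    using assms(2) by (auto simp: complex_eq_iff)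
  then have "1 \<le> \<bar>m\<bar> \<or> 1 \<le> \<bar>n\<bar>"
    by linarith
  then have "1 \<le> \<bar>Re g\<bar> \<or> 1 \<le> \<bar>Im g\<bar>"
    unfolding g by (simp flip: of_int_abs)
  then show ?thesis
    using abs_Re_le_cmod[of g] abs_Im_le_cmod[of g] by linarith
qed

text \<open>The packing bound is applied to the points q c + i + j \<i> with q \<le> n and i, j < M,
  as M tends to infinity. The factor \<open>real n + 1\<close> includes q = 0: differences of
  distinct indices still lie between 1 and n in absolute value.\<close>

lemma psi_packing_bound:
  fixes n :: nat and c :: complex
  assumes n: "1 \<le> n"
  shows "(real n + 1) * (psi c (real n))\<^sup>2 \<le> 2 / sqrt 3"
proof (cases "psi c (real n) = 0")
  case True
  then show ?thesis by simp
next
  case False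
  define \<zeta> where "\<zeta> = psi c (real n)"
  have n1: "1 \<le> real n" using n by simp
  have \<zeta>: "0 < \<zeta>" "\<zeta> \<le> 1"
    using False psi_nonneg[OF n1, of c] psi_le_1[OF n1, of c] by (auto simp: \<zeta>_def)
  \<comment> \<open>The scale that turns the minimal distance \<open>\<zeta>\<close> into the
    \<open>sqrt 3\<close> of the packing bound.\<close>
  define k where "k = sqrt 3 / \<zeta>"
  have k: "0 < k" "k * \<zeta> = sqrt 3"
    using \<zeta> by (auto simp: k_def)
  define z where "z = (\<lambda>(q, i, j). of_nat q * c + Complex (of_nat i) (of_nat j))"
  define pt where "pt = (\<lambda>t. k *\<^sub>R (vector [Re (z t), Im (z t)] :: real ^ 2))"
  \<comment> \<open>Bounds how far a multiple of \<open>c\<close> can push a point out of the square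
    of side \<open>M\<close>.\<close>
  define K where "K = real n * cmod c"
  have dist_pt: "dist (pt s) (pt t) = k * cmod (z s - z t)" for s t
    unfolding dist_norm pt_def using k
    by (simp add: norm_real2 cmod_def power_mult_distrib real_sqrt_mult flip: right_diff_distrib distrib_left)
  have close: "\<zeta> \<le> cmod (of_nat q * c - g)" if "1 \<le> q" "q \<le> n" "g \<in> gauss_ints" for q g
    using psi_le[of q "real n" c] torus_norm_le[of g "of_nat q * c"] that by (simp add: \<zeta>_def)
  have gd: "Complex (of_nat i) (of_nat j) - Complex (of_nat i') (of_nat j') \<in> gauss_ints" for i j i' j'
    by (intro gauss_ints_diff) (auto simp: gauss_ints_def intro: exI[of _ "int _"])
  have lt: "\<zeta> \<le> cmod (z (q, i, j) - z (q', i', j'))" if "q' < q" "q \<le> n" for q i j q' i' j'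
  proof -
    have "z (q, i, j) - z (q', i', j') = of_nat (q - q') * c - (Complex (of_nat i') (of_nat j') - Complex (of_nat i) (of_nat j))"
      using that by (simp add: z_def of_nat_diff algebra_simps)
    then show ?thesis
      using close[OF _ _ gd, of "q - q'" i' j' i j] that by simp
  qed
  have sep: "\<zeta> \<le> cmod (z (q, i, j) - z (q', i', j'))"
    if "q \<le> n" "q' \<le> n" "(q, i, j) \<noteq> (q', i', j')" for q i j q' i' j'
  proof -
    consider "q' < q" | "q < q'" | "q = q'" by linarith
    then show ?thesis
    proof cases
      case 1
      then show ?thesis using lt that by blast
    next
      case 2
      then show ?thesis using lt[of q q' i' j' i j] that by (simp add: norm_minus_commute)
    next
      \<comment> \<open>Distinct translates of the same multiple differ by a nonzero Gaussian
        integer, of modulus at least 1 and hence at least \<open>\<zeta>\<close>.\<close>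
      case 3
      then have "z (q, i, j) - z (q', i', j') = Complex (of_nat i) (of_nat j) - Complex (of_nat i') (of_nat j')"
        by (simp add: z_def)
      moreover have "\<dots> \<noteq> 0"
        using 3 that by (auto simp: complex_eq_iff)
      ultimately show ?thesis
        using cmod_gauss_int_ge_1[OF gd] \<zeta> by (metis order_trans)
    qed
  qed
  \<comment> \<open>The scaled square has side \<open>k * real M\<close>; the margins are
    \<open>k * K\<close> on each side for the multiples of \<open>c\<close> and 1 on each side for
    the unit balls.\<close>
  have bound: "(real n + 1) * (real M)\<^sup>2 * (3 * sqrt 3 / 2) \<le> (k * real M + (2 * k * K + 2))\<^sup>2" for M :: nat
  proof -
    define I where "I = {..n} \<times> {..<M} \<times> {..<M}"
    have sepI: "sqrt 3 \<le> dist (pt s) (pt t)" if "s \<in> I" "t \<in> I" "s \<noteq> t" for s t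
    proof -
      obtain q i j q' i' j' where st: "s = (q, i, j)" "t = (q', i', j')"
        by (metis prod_cases3)
      have "\<zeta> \<le> cmod (z s - z t)"
        using that sep unfolding st by (auto simp: I_def)
      then have "k * \<zeta> \<le> k * cmod (z s - z t)"
        using k by (intro mult_left_mono) auto
      then show ?thesis
        using k dist_pt by simp
    qed
    have inj: "inj_on pt I"
    proof (rule inj_onI, rule ccontr)
      fix s t assume "s \<in> I" "t \<in> I" "pt s = pt t" "s \<noteq> t"
      then show False using sepI[of s t] by simp
    qed
    define a b :: "real ^ 2" where
      "a = vector [- (k * K) - 1, - (k * K) - 1]" and
      "b = vector [k * (real M + K) + 1, k * (real M + K) + 1]"
    have K0: "0 \<le> K" by (simp add: K_def)
    have "real (card (pt ` I)) * (3 * sqrt 3 / 2) \<le> measure lebesgue (cbox a b)"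
    proof (rule planar_packing_bound)
      show "finite (pt ` I)" by (simp add: I_def)
      show "sqrt 3 \<le> dist x y" if "x \<in> pt ` I" "y \<in> pt ` I" "x \<noteq> y" for x y
        using that sepI by (metis imageE)
      fix p assume "p \<in> pt ` I"
      then obtain q i j where p: "p = pt (q, i, j)" "q \<le> n" "i < M" "j < M"
        by (auto simp: I_def)
      have *: "- K \<le> real q * t" "real q * t \<le> K" if "\<bar>t\<bar> \<le> cmod c" for t
      proof -
        have "\<bar>real q * t\<bar> \<le> K"
          unfolding K_def abs_mult using p that by (intro mult_mono) auto
        then show "- K \<le> real q * t" "real q * t \<le> K" by auto
      qed
      have c1: "- K \<le> Re (z (q, i, j))" "Re (z (q, i, j)) \<le> real M + K"
        "- K \<le> Im (z (q, i, j))" "Im (z (q, i, j)) \<le> real M + K"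
        using *[OF abs_Re_le_cmod] *[OF abs_Im_le_cmod] p by (auto simp: z_def)
      have c2: "- (k * K) \<le> k * u" "k * v \<le> k * (real M + K)" if "- K \<le> u" "v \<le> real M + K" for u v
        using mult_left_mono[OF that(1), of k] mult_left_mono[OF that(2), of k] k by auto
      show "ball p 1 \<subseteq> cbox a b"
      proof
        fix x assume "x \<in> ball p 1"
        then have "norm (x - p) < 1"
          by (simp add: dist_norm norm_minus_commute)
        then have "\<bar>x $ l - p $ l\<bar> < 1" for l
          using component_le_norm_cart[of "x - p" l] by simp
        from this[of 1] this[of 2] show "x \<in> cbox a b"
          using c2[OF c1(1,2)] c2[OF c1(3,4)]
          by (auto simp: mem_box_cart forall_2 a_def b_def p(1) pt_def abs_less_iff)
      qed
    qed
    also have "card (pt ` I) = (n + 1) * M\<^sup>2"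
      using inj by (simp add: card_image I_def card_cartesian_product power2_eq_square)
    also have "measure lebesgue (cbox a b) = (k * real M + (2 * k * K + 2))\<^sup>2"
    proof -
      have "- (k * K) - 1 \<le> k * (real M + K) + 1"
      proof -
        have "0 \<le> k * K" "0 \<le> k * (real M + K)" using k K0 by auto
        then show ?thesis by linarith
      qed
      then have "measure lebesgue (cbox a b) = (\<Prod>i\<in>UNIV. b $ i - a $ i)"
        by (simp add: content_cbox_cart interval_ne_empty_cart forall_2 a_def b_def)
      then show ?thesis
        by (simp add: UNIV_2 a_def b_def power2_eq_square algebra_simps)
    qed
    finally show ?thesis
      by (simp add: algebra_simps)
  qed
  define L where "L = 2 * k * K + 2"
  \<comment> \<open>The margin \<open>L\<close> does not depend on \<open>M\<close>, so it
    disappears after division by M^2 in the limit.\<close>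
  have "(real n + 1) * (3 * sqrt 3 / 2) \<le> k\<^sup>2"
  proof (rule LIMSEQ_le_const)
    have "(\<lambda>M. (k + L * (1 / real M))\<^sup>2) \<longlonglongrightarrow> (k + L * 0)\<^sup>2"
      by (intro tendsto_intros lim_1_over_n)
    then show "(\<lambda>M. (k + L * (1 / real M))\<^sup>2) \<longlonglongrightarrow> k\<^sup>2"
      by simp
    show "\<exists>N. \<forall>M\<ge>N. (real n + 1) * (3 * sqrt 3 / 2) \<le> (k + L * (1 / real M))\<^sup>2"
    proof (intro exI[of _ 1] allI impI)
      fix M :: nat assume M: "1 \<le> M"
      have "((real n + 1) * (3 * sqrt 3 / 2)) * (real M)\<^sup>2 \<le> (k * real M + L)\<^sup>2"
        using bound[of M] by (simp add: L_def algebra_simps)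
      also have "\<dots> = (k + L * (1 / real M))\<^sup>2 * (real M)\<^sup>2"
        using M by (simp add: power_mult_distrib[symmetric] field_simps)
      finally show "(real n + 1) * (3 * sqrt 3 / 2) \<le> (k + L * (1 / real M))\<^sup>2"
        using M by simp
    qed
  qed
  also have "k\<^sup>2 = 3 / \<zeta>\<^sup>2"
    by (simp add: k_def power_divide)
  finally have "(real n + 1) * \<zeta>\<^sup>2 * (3 * sqrt 3 / 2) \<le> 3"
    using \<zeta> by (simp add: field_simps)
  moreover have "2 / sqrt 3 * (3 * sqrt 3 / 2) = (3::real)"
    by simp
  ultimately have "(real n + 1) * \<zeta>\<^sup>2 * (3 * sqrt 3 / 2) \<le> 2 / sqrt 3 * (3 * sqrt 3 / 2)"
    by linarith
  then show ?thesis
    unfolding \<zeta>_def by (rule mult_right_le_imp_le) simp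
qed

text \<open>If n is the integer part of \<open>t\<close>, then \<open>psi c t\<close> is at most
  \<open>psi c n\<close> and t \<le> n + 1. This is where the extra 1 in
  \<open>psi_packing_bound\<close> is spent.\<close>

lemma t_psi_sq_le:
  assumes "1 \<le> t"
  shows "t * (psi c t)\<^sup>2 \<le> 2 / sqrt 3"
proof -
  define n where "n = nat \<lfloor>t\<rfloor>"
  have n: "1 \<le> n" "real n \<le> t" "t \<le> real n + 1"
    using assms by (auto simp: n_def le_nat_floor)
  have "1 \<le> real n" using n by simp
  from psi_attained[OF this, of c] obtain q
    where q: "1 \<le> q" "real q \<le> real n" "psi c (real n) = torus_norm (of_nat q * c)" .
  then have "psi c t \<le> psi c (real n)"
    using psi_le[of q t c] n by simp
  then have "t * (psi c t)\<^sup>2 \<le> (real n + 1) * (psi c (real n))\<^sup>2"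
    using n assms psi_nonneg[OF assms] by (intro mult_mono power_mono) auto
  also have "\<dots> \<le> 2 / sqrt 3"
    by (rule psi_packing_bound[OF n(1)])
  finally show ?thesis .
qed

section \<open>Attaining every value\<close>

text \<open>The six data describe a basis \<open>(Q, 0), (a, x), (b, y)\<close> of the unimodular lattice
  \<open>{(q, q r - g)}\<close>, where \<open>q\<close> ranges over the integers and \<open>g\<close> over the Gaussian integers. In
  particular \<open>x\<close> and \<open>y\<close> span the planar lattice of the multiples of \<open>r\<close> modulo the Gaussian
  integers, whose covolume is \<open>1 / Q\<close>.\<close>

definition lattice_frame :: "int \<Rightarrow> complex \<Rightarrow> int \<Rightarrow> int \<Rightarrow> complex \<Rightarrow> complex \<Rightarrow> bool" where
  "lattice_frame Q r a b x y \<longleftrightarrow>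
     Q > 0 \<and> of_int Q * r \<in> gauss_ints \<and>
     x - of_int a * r \<in> gauss_ints \<and> y - of_int b * r \<in> gauss_ints \<and>
     of_int Q * (Re x * Im y - Im x * Re y) = 1 \<and>
     (\<forall>q. \<forall>g\<in>gauss_ints. \<exists>k i j. q = k * Q + i * a + j * b \<and>
        of_int q * r - g = of_int i * x + of_int j * y)"

lemma lattice_frame_init: "lattice_frame 1 0 0 0 1 \<i>"
proof -
  have "\<exists>k i j. q = k * 1 + i * 0 + j * 0 \<and> of_int q * 0 - g = of_int i * 1 + of_int j * \<i>"
    if g: "g \<in> gauss_ints" for q :: int and g
  proof -
    obtain m n where "g = Complex (of_int m) (of_int n)"
      using g by (auto simp: gauss_ints_def)
    then show ?thesis
      by (intro exI[of _ q] exI[of _ "- m"] exI[of _ "- n"]) (simp add: complex_eq_iff)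
  qed
  moreover have "1 \<in> gauss_ints" "\<i> \<in> gauss_ints"
    unfolding gauss_ints_def
    by (force simp: complex_eq_iff intro: exI[of _ "1::int"] exI[of _ "0::int"])+
  ultimately show ?thesis
    unfolding lattice_frame_def by (simp add: gauss_ints_0)
qed

text \<open>With \<open>e\<^sub>1, e\<^sub>2, e\<^sub>3\<close> the old basis, the new one is the image of
  \<open>B U - h e\<^sub>1 - e\<^sub>3, e\<^sub>1, U\<close>, where \<open>U = A e\<^sub>1 - e\<^sub>2\<close>, under the shear \<open>(q, z) \<mapsto> (q, z + q \<delta>)\<close>. The
  shift \<open>\<delta>\<close> is the one that makes the first of these vectors vertical.\<close>

lemma lattice_frame_step:
  fixes A B h :: int
  assumes F: "lattice_frame Q r a b x y"
    and Q': "Q' = (A * B - h) * Q - B * a - b" "Q' > 0"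
    and \<delta>: "\<delta> = (of_int B * x + y) / of_int Q'"
  shows "lattice_frame Q' (r + \<delta>) Q (A * Q - a) (of_int Q * \<delta>) (of_int (A * Q - a) * \<delta> - x)"
proof -
  note F' = F[unfolded lattice_frame_def]
  have G: "of_int Q * r \<in> gauss_ints" "x - of_int a * r \<in> gauss_ints" "y - of_int b * r \<in> gauss_ints"
    using F' by auto
  have Q'\<delta>: "of_int Q' * \<delta> = of_int B * x + y"
    using \<delta> Q'(2) by simp
  have Q'c: "(of_int Q' :: complex) = (of_int A * of_int B - of_int h) * of_int Q - of_int B * of_int a - of_int b"
    by (simp add: Q'(1))
  have 1: "of_int Q' * (r + \<delta>) \<in> gauss_ints"
  proof -
    have "of_int Q' * (r + \<delta>) = of_int Q' * r + (of_int B * x + y)"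
      by (simp add: distrib_left Q'\<delta>)
    also have "\<dots> = of_int (A * B - h) * (of_int Q * r) + of_int B * (x - of_int a * r) + (y - of_int b * r)"
      by (simp add: Q'c algebra_simps)
    also have "\<dots> \<in> gauss_ints"
      by (intro gauss_ints_add gauss_ints_mult[OF G(1)] gauss_ints_mult[OF G(2)] G(3))
    finally show ?thesis .
  qed
  have 2: "of_int Q * \<delta> - of_int Q * (r + \<delta>) \<in> gauss_ints"
  proof -
    have "of_int Q * \<delta> - of_int Q * (r + \<delta>) = - (of_int Q * r)"
      by (simp add: algebra_simps)
    then show ?thesis
      using F' gauss_ints_uminus by metis
  qed
  have 3: "of_int (A * Q - a) * \<delta> - x - of_int (A * Q - a) * (r + \<delta>) \<in> gauss_ints"
  proof -
    have "of_int (A * Q - a) * \<delta> - x - of_int (A * Q - a) * (r + \<delta>)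
        = of_int (- A) * (of_int Q * r) - (x - of_int a * r)"
      by (simp add: algebra_simps)
    also have "\<dots> \<in> gauss_ints"
      by (intro gauss_ints_diff gauss_ints_mult[OF G(1)] G(2))
    finally show ?thesis .
  qed
  \<comment> \<open>Substituting \<open>Q' \<delta> = B x + y\<close> reduces the new determinant to
    the old one.\<close>
  have 4: "of_int Q' * (Re (of_int Q * \<delta>) * Im (of_int (A * Q - a) * \<delta> - x)
      - Im (of_int Q * \<delta>) * Re (of_int (A * Q - a) * \<delta> - x)) = 1"
  proof -
    have re: "of_int Q' * Re \<delta> = of_int B * Re x + Re y"
      using arg_cong[OF Q'\<delta>, of Re] by simp
    have im: "of_int Q' * Im \<delta> = of_int B * Im x + Im y"
      using arg_cong[OF Q'\<delta>, of Im] by simp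
    have "of_int Q' * (Re (of_int Q * \<delta>) * Im (of_int (A * Q - a) * \<delta> - x)
        - Im (of_int Q * \<delta>) * Re (of_int (A * Q - a) * \<delta> - x))
      = of_int Q * ((of_int Q' * Im \<delta>) * Re x - (of_int Q' * Re \<delta>) * Im x)"
      by (simp add: algebra_simps)
    also have "\<dots> = of_int Q * (Re x * Im y - Im x * Re y)"
      unfolding re im by (simp add: algebra_simps)
    finally show ?thesis
      using F' by simp
  qed
  have 5: "\<exists>k i j. q = k * Q' + i * Q + j * (A * Q - a) \<and>
        of_int q * (r + \<delta>) - g = of_int i * (of_int Q * \<delta>) + of_int j * (of_int (A * Q - a) * \<delta> - x)"
    if gG: "g \<in> gauss_ints" for q g
  proof -
    obtain k i j where q: "q = k * Q + i * a + j * b"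
      and g: "of_int q * r - g = of_int i * x + of_int j * y"
      using F' gG by blast
    \<comment> \<open>The coordinates of k e1 + i e2 + j e3 in the new basis, found from e2 = A e1 -
      U and e3 = B U - h e1 - e1', where e1' is the first new basis vector before the shear.\<close>
    define k' i' j' where "k' = - j" and "i' = k + i * A - j * h" and "j' = j * B - i"
    have q': "q = k' * Q' + i' * Q + j' * (A * Q - a)"
      unfolding q k'_def i'_def j'_def Q' by (simp add: algebra_simps)
    have "of_int i' * (of_int Q * \<delta>) + of_int j' * (of_int (A * Q - a) * \<delta> - x)
        = of_int (i' * Q + j' * (A * Q - a)) * \<delta> - of_int j' * x"
      by (simp add: algebra_simps)
    also have "i' * Q + j' * (A * Q - a) = q + j * Q'"
      using q' by (simp add: k'_def)
    also have "of_int (q + j * Q') * \<delta> - of_int j' * x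
        = of_int q * \<delta> + of_int j * (of_int Q' * \<delta>) - of_int j' * x"
      by (simp add: algebra_simps)
    also have "\<dots> = of_int q * \<delta> + (of_int i * x + of_int j * y)"
      unfolding Q'\<delta> j'_def by (simp add: algebra_simps)
    also have "\<dots> = of_int q * (r + \<delta>) - g"
      unfolding g[symmetric] by (simp add: algebra_simps)
    finally show ?thesis
      using q' by metis
  qed
  show ?thesis
    unfolding lattice_frame_def using Q'(2) 1 2 3 4 5 by blast
qed

text \<open>The lattice spanned by U and U (1/2 - \<i>/\<theta>) has covolume |U|^2 / \<theta>. Its
  squared norm is |U|^2 times (i/2 + j)^2 + i^2/\<theta>^2, and
  \<open>\<theta> \<le> 2 / sqrt 3\<close> means 1/\<theta>^2 \<ge> 3/4. Hence |U| is the minimum,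
  and its square divided by the covolume is \<theta>.\<close>

lemma hexagonal_lattice_norm_ge:
  fixes U :: complex and \<theta> :: real and i j :: int
  assumes "0 < \<theta>" "\<theta> \<le> 2 / sqrt 3"
  shows "(cmod U)\<^sup>2 * of_int (i\<^sup>2 + i * j + j\<^sup>2)
    \<le> (cmod (of_int i * (U * Complex (1/2) (- 1/\<theta>)) + of_int j * U))\<^sup>2"
proof -
  have "\<theta> * sqrt 3 \<le> 2"
    using assms(2) by (simp add: field_simps)
  then have "(\<theta> * sqrt 3)\<^sup>2 \<le> 2\<^sup>2"
    using assms(1) by (intro power_mono) auto
  then have "3 / 4 \<le> 1 / \<theta>\<^sup>2"
    using assms(1) by (simp add: field_simps power_mult_distrib)
  then have "(of_int i)\<^sup>2 * (3 / 4) \<le> (of_int i)\<^sup>2 * (1 / \<theta>\<^sup>2)"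
    by (intro mult_left_mono) auto
  moreover have "(of_int i / 2 + of_int j)\<^sup>2 = (of_int i)\<^sup>2 / 4 + of_int i * of_int j + (of_int j :: real)\<^sup>2"
    by (simp add: power2_sum power_divide)
  moreover have "(of_int i / \<theta>)\<^sup>2 = (of_int i)\<^sup>2 * (1 / \<theta>\<^sup>2)"
    by (simp add: power_divide)
  ultimately have le: "of_int (i\<^sup>2 + i * j + j\<^sup>2) \<le> (of_int i / 2 + of_int j)\<^sup>2 + (of_int i / \<theta>)\<^sup>2"
    unfolding of_int_add of_int_mult of_int_power by linarith
  have "of_int i * (U * Complex (1/2) (- 1/\<theta>)) + of_int j * U
      = U * Complex (of_int i / 2 + of_int j) (- (of_int i / \<theta>))"
    by (simp add: complex_eq_iff algebra_simps)
  then have "(cmod (of_int i * (U * Complex (1/2) (- 1/\<theta>)) + of_int j * U))\<^sup>2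
      = (cmod U)\<^sup>2 * ((of_int i / 2 + of_int j)\<^sup>2 + (of_int i / \<theta>)\<^sup>2)"
    by (simp add: norm_mult power_mult_distrib cmod_power2)
  then show ?thesis
    using le by (simp add: mult_left_mono)
qed

text \<open>With s = |i| + |j|, the perturbation costs at most s \<eta>, but the unperturbed norm is
  at least s |U| / 2. So the loss can be bounded uniformly in \<open>i\<close> and
  \<open>j\<close>.\<close>

lemma perturbed_lattice_norm_ge:
  fixes U X' U' :: complex and \<theta> :: real and i j :: int
  assumes \<theta>: "0 < \<theta>" "\<theta> \<le> 2 / sqrt 3" and ij: "i \<noteq> 0 \<or> j \<noteq> 0"
    and \<eta>: "cmod (X' - U * Complex (1/2) (- 1/\<theta>)) \<le> \<eta>" "cmod (U' - U) \<le> \<eta>"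
    and small: "2 * \<eta> \<le> cmod U"
  shows "cmod U - 2 * \<eta> \<le> cmod (of_int i * X' + of_int j * U')"
proof -
  define X where "X = U * Complex (1/2) (- 1/\<theta>)"
  define s where "s = \<bar>i\<bar> + \<bar>j\<bar>"
  define L where "L = cmod (of_int i * X + of_int j * U)"
  have \<eta>0: "0 \<le> \<eta>"
    using \<eta>(2) norm_ge_zero order_trans by blast
  have L0: "0 \<le> L"
    by (simp add: L_def)
  note H = hexagonal_lattice_norm_ge[OF \<theta>, of U i j, folded X_def, folded L_def]
  have "s\<^sup>2 \<le> 4 * (i\<^sup>2 + i * j + j\<^sup>2)"
  proof -
    have "\<bar>i * j\<bar> = \<bar>i\<bar> * \<bar>j\<bar>"
      by (simp add: abs_mult)
    then have ij: "- (\<bar>i\<bar> * \<bar>j\<bar>) \<le> i * j"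
      by linarith
    have "0 \<le> 3 * (\<bar>i\<bar> - \<bar>j\<bar>)\<^sup>2"
      by simp
    also have "\<dots> = 4 * (i\<^sup>2 - \<bar>i\<bar> * \<bar>j\<bar> + j\<^sup>2) - s\<^sup>2"
      by (simp add: s_def power2_eq_square algebra_simps)
    finally have "s\<^sup>2 \<le> 4 * (i\<^sup>2 - \<bar>i\<bar> * \<bar>j\<bar> + j\<^sup>2)"
      by simp
    also have "\<dots> \<le> 4 * (i\<^sup>2 + i * j + j\<^sup>2)"
      using ij by simp
    finally show ?thesis .
  qed
  then have "real_of_int (s\<^sup>2) \<le> real_of_int (4 * (i\<^sup>2 + i * j + j\<^sup>2))"
    by (simp only: of_int_le_iff)
  then have "(cmod U)\<^sup>2 * (of_int s)\<^sup>2 \<le> (cmod U)\<^sup>2 * (4 * of_int (i\<^sup>2 + i * j + j\<^sup>2))"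
    by (intro mult_left_mono) auto
  also have "\<dots> \<le> (2 * L)\<^sup>2"
  proof -
    have "(2 * L)\<^sup>2 = 4 * L\<^sup>2"
      by simp
    then show ?thesis
      using H by linarith
  qed
  finally have "(cmod U * of_int s)\<^sup>2 \<le> (2 * L)\<^sup>2"
    by (simp add: power_mult_distrib)
  then have sL: "cmod U * of_int s \<le> 2 * L"
    by (rule power2_le_imp_le) (use L0 in simp)
  have s1: "1 \<le> real_of_int s"
    using ij by (auto simp: s_def)
  have "cmod (of_int i * (X - X') + of_int j * (U - U')) \<le> of_int \<bar>i\<bar> * \<eta> + of_int \<bar>j\<bar> * \<eta>"
  proof (rule norm_triangle_le[OF add_mono])
    show "cmod (of_int i * (X - X')) \<le> of_int \<bar>i\<bar> * \<eta>"
      using \<eta>(1) by (simp add: norm_mult X_def norm_minus_commute mult_left_mono)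
    show "cmod (of_int j * (U - U')) \<le> of_int \<bar>j\<bar> * \<eta>"
      using \<eta>(2) by (simp add: norm_mult norm_minus_commute mult_left_mono)
  qed
  then have "L \<le> cmod (of_int i * X' + of_int j * U') + of_int s * \<eta>"
    unfolding L_def s_def
    using norm_triangle_ineq[of "of_int i * X' + of_int j * U'" "of_int i * (X - X') + of_int j * (U - U')"]
    by (simp add: algebra_simps)
  \<comment> \<open>For s = 1 the bound s |U| / 2 is too weak, but there the quadratic form equals 1
    and \<open>L\<close> is at least |U|.\<close>
  moreover have "cmod U - 2 * \<eta> \<le> (cmod U / 2 - \<eta>) * of_int s * 1 + (L - cmod U / 2 * of_int s)"
  proof (cases "s = 1")
    case True
    then have "(i = 0 \<and> (j = 1 \<or> j = -1)) \<or> (j = 0 \<and> (i = 1 \<or> i = -1))"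
      unfolding s_def by linarith
    then have "i\<^sup>2 + i * j + j\<^sup>2 = 1"
      by auto
    then have "(cmod U)\<^sup>2 \<le> L\<^sup>2"
      using H by simp
    then have "cmod U \<le> L"
      using L0 power2_le_imp_le by blast
    then show ?thesis
      using True \<eta>0 by (simp add: field_simps)
  next
    case False
    then have "2 \<le> real_of_int s"
      using s1 by (simp add: s_def)
    then have "(cmod U / 2 - \<eta>) * 2 \<le> (cmod U / 2 - \<eta>) * of_int s"
      using small by (intro mult_left_mono) auto
    then show ?thesis
      using sL by simp
  qed
  ultimately show ?thesis
    by (simp add: algebra_simps)
qed

section \<open>Limits of the rescaled next lattice\<close>

lemma floor_mult_over_n_tendsto: "(\<lambda>n. of_int \<lfloor>c * real n\<rfloor> / real n) \<longlonglongrightarrow> c"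
proof (rule real_tendsto_sandwich)
  show "\<forall>\<^sub>F n in sequentially. c - 1 / real n \<le> of_int \<lfloor>c * real n\<rfloor> / real n"
    using eventually_gt_at_top[of 0]
  proof eventually_elim
    case (elim n)
    have "c * real n - 1 \<le> of_int \<lfloor>c * real n\<rfloor>"
      by linarith
    then have "(c * real n - 1) / real n \<le> of_int \<lfloor>c * real n\<rfloor> / real n"
      by (rule divide_right_mono) simp
    then show ?case
      using elim by (simp add: diff_divide_distrib)
  qed
  show "\<forall>\<^sub>F n in sequentially. of_int \<lfloor>c * real n\<rfloor> / real n \<le> c"
    using eventually_gt_at_top[of 0]
    by eventually_elim (simp add: field_simps)
  show "(\<lambda>n. c - 1 / real n) \<longlonglongrightarrow> c"
    using tendsto_diff[OF tendsto_const lim_1_over_n, of c] by simp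
qed simp

text \<open>Taking \<open>A = n\<close> and rounding \<open>\<beta> n\<close> and \<open>\<tau> n\<close>, the new planar lattice, rescaled by \<open>n\<close>,
  approaches the lattice spanned by \<open>x\<close> and \<open>(y + \<tau> x) / \<beta>\<close>; as \<open>\<beta> > 0\<close> and \<open>\<tau>\<close> are free, every
  shape is available.\<close>

lemma lattice_frame_asymptotics:
  assumes F: "lattice_frame Q r a b x y" and \<beta>: "\<beta> > 0" and U: "of_real \<beta> * U = y + of_real \<tau> * x"
  defines "B \<equiv> \<lambda>n::nat. \<lfloor>\<beta> * real n\<rfloor>" and "h \<equiv> \<lambda>n::nat. \<lfloor>\<tau> * real n\<rfloor>"
  defines "R \<equiv> \<lambda>n. (int n * B n - h n) * Q - B n * a - b"
  defines "\<delta> \<equiv> \<lambda>n. (of_int (B n) * x + y) / of_int (R n)"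
  shows "(\<lambda>n. of_int (R n) / (real n)\<^sup>2) \<longlonglongrightarrow> \<beta> * of_int Q"
    and "(\<lambda>n. of_nat n * (of_int Q * \<delta> n)) \<longlonglongrightarrow> x"
    and "(\<lambda>n. of_nat n * (of_int (int n * Q - a) * \<delta> n - x)) \<longlonglongrightarrow> U"
proof -
  have Q: "Q > 0"
    using F by (simp add: lattice_frame_def)
  have Bn: "(\<lambda>n. of_int (B n) / real n) \<longlonglongrightarrow> \<beta>" and hn: "(\<lambda>n. of_int (h n) / real n) \<longlonglongrightarrow> \<tau>"
    unfolding B_def h_def by (rule floor_mult_over_n_tendsto)+
  note in0 = lim_inverse_n[where 'a = real, unfolded inverse_eq_divide]
  show R: "(\<lambda>n. of_int (R n) / (real n)\<^sup>2) \<longlonglongrightarrow> \<beta> * of_int Q"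
  proof (rule Lim_transform_eventually)
    show "\<forall>\<^sub>F n in sequentially. (of_int (B n) / real n - of_int (h n) / real n * (1 / real n)) * of_int Q
        - (of_int (B n) / real n) * of_int a * (1 / real n) - of_int b * (1 / real n) * (1 / real n)
        = of_int (R n) / (real n)\<^sup>2"
      using eventually_gt_at_top[of 0]
      by eventually_elim (simp add: R_def field_simps power2_eq_square)
    have "(\<lambda>n. (of_int (B n) / real n - of_int (h n) / real n * (1 / real n)) * of_int Q
        - (of_int (B n) / real n) * of_int a * (1 / real n) - of_int b * (1 / real n) * (1 / real n))
      \<longlonglongrightarrow> (\<beta> - \<tau> * 0) * of_int Q - \<beta> * of_int a * 0 - of_int b * 0 * 0"
      by (intro tendsto_intros Bn hn in0)
    then show "(\<lambda>n. (of_int (B n) / real n - of_int (h n) / real n * (1 / real n)) * of_int Q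
        - (of_int (B n) / real n) * of_int a * (1 / real n) - of_int b * (1 / real n) * (1 / real n))
      \<longlonglongrightarrow> \<beta> * of_int Q"
      by simp
  qed
  have lim0: "\<beta> * of_int Q \<noteq> 0"
    using \<beta> Q by simp
  have pos: "\<forall>\<^sub>F n in sequentially. of_int (R n) / (real n)\<^sup>2 > 0"
    using order_tendstoD(1)[OF R, of 0] \<beta> Q by simp
  define \<rho> where "\<rho> = (\<lambda>n. complex_of_real (of_int (R n) / (real n)\<^sup>2))"
  have \<rho>: "\<rho> \<longlonglongrightarrow> of_real (\<beta> * of_int Q)"
    unfolding \<rho>_def by (intro tendsto_intros R)
  have \<rho>': "complex_of_real (\<beta> * of_int Q) \<noteq> 0"
    using lim0 by simp
  show "(\<lambda>n. of_nat n * (of_int Q * \<delta> n)) \<longlonglongrightarrow> x"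
  proof (rule Lim_transform_eventually)
    show "\<forall>\<^sub>F n in sequentially. of_int Q * (of_real (of_int (B n) / real n) * x + of_real (1 / real n) * y) / \<rho> n
        = of_nat n * (of_int Q * \<delta> n)"
      using eventually_gt_at_top[of 0] pos
    proof eventually_elim
      case (elim n)
      then have "R n \<noteq> 0" by auto
      with elim show ?case
        unfolding \<rho>_def \<delta>_def by (simp add: field_simps power2_eq_square)
    qed
    have "(\<lambda>n. of_int Q * (of_real (of_int (B n) / real n) * x + of_real (1 / real n) * y) / \<rho> n)
       \<longlonglongrightarrow> of_int Q * (of_real \<beta> * x + of_real 0 * y) / of_real (\<beta> * of_int Q)"
      by (intro tendsto_intros Bn in0 \<rho> \<rho>')
    then show "(\<lambda>n. of_int Q * (of_real (of_int (B n) / real n) * x + of_real (1 / real n) * y) / \<rho> n) \<longlonglongrightarrow> x"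
      using \<beta> Q by simp
  qed
  show "(\<lambda>n. of_nat n * (of_int (int n * Q - a) * \<delta> n - x)) \<longlonglongrightarrow> U"
  proof (rule Lim_transform_eventually)
    show "\<forall>\<^sub>F n in sequentially. ((of_int Q - of_int a * of_real (1 / real n)) * y
        + (of_real (of_int (h n) / real n) * of_int Q + of_int b * of_real (1 / real n)) * x) / \<rho> n
        = of_nat n * (of_int (int n * Q - a) * \<delta> n - x)"
      using eventually_gt_at_top[of 0] pos
    proof eventually_elim
      case (elim n)
      then have R0: "R n \<noteq> 0" by auto
      \<comment> \<open>Over the common denominator \<open>R n\<close> the terms with
        \<open>B n\<close> cancel. The numerator is then of order n against n^2 below, so the vector
        has size of order 1/n.\<close>
      have "of_int (int n * Q - a) * \<delta> n - x
          = (of_int (int n * Q - a) * (of_int (B n) * x + y) - of_int (R n) * x) / of_int (R n)"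
        using R0 by (simp add: \<delta>_def field_simps)
      also have "of_int (int n * Q - a) * (of_int (B n) * x + y) - of_int (R n) * x
          = (of_nat n * of_int Q - of_int a) * y + (of_int (h n) * of_int Q + of_int b) * x"
        by (simp add: R_def algebra_simps)
      finally have eq: "of_int (int n * Q - a) * \<delta> n - x =
          ((of_nat n * of_int Q - of_int a) * y + (of_int (h n) * of_int Q + of_int b) * x) / of_int (R n)" .
      show ?case
        unfolding eq \<rho>_def using elim R0 by (simp add: field_simps power2_eq_square)
    qed
    have "(\<lambda>n. ((of_int Q - of_int a * of_real (1 / real n)) * y
        + (of_real (of_int (h n) / real n) * of_int Q + of_int b * of_real (1 / real n)) * x) / \<rho> n)
       \<longlonglongrightarrow> ((of_int Q - of_int a * of_real 0) * y
        + (of_real \<tau> * of_int Q + of_int b * of_real 0) * x) / of_real (\<beta> * of_int Q)"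
      by (intro tendsto_intros hn in0 \<rho> \<rho>')
    also have "((of_int Q - of_int a * of_real 0) * y
        + (of_real \<tau> * of_int Q + of_int b * of_real 0) * x) / of_real (\<beta> * of_int Q)
        = of_int Q * (y + of_real \<tau> * x) / of_real (\<beta> * of_int Q)"
      by (simp add: algebra_simps)
    also have "\<dots> = U"
      unfolding U[symmetric] using \<beta> Q by simp
    finally show "(\<lambda>n. ((of_int Q - of_int a * of_real (1 / real n)) * y
        + (of_real (of_int (h n) / real n) * of_int Q + of_int b * of_real (1 / real n)) * x) / \<rho> n)
       \<longlonglongrightarrow> U" .
  qed
qed

text \<open>The inductive step of the construction: \<open>lattice_frame_step\<close> with a large
  \<open>n\<close>, its parameters tuned so that the new planar lattice is nearly similar to that of
  \<open>hexagonal_lattice_norm_ge\<close>.\<close>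

lemma lattice_frame_next:
  fixes \<theta> \<epsilon> :: real
  assumes F: "lattice_frame Q r a b x y" and \<theta>: "0 < \<theta>" "\<theta> \<le> 2 / sqrt 3" and \<epsilon>: "0 < \<epsilon>"
  obtains Q' r' a' b' x' y' where
    "lattice_frame Q' r' a' b' x' y'" "Q < Q'" "cmod (r' - r) \<le> \<epsilon>"
    "\<And>t. of_int Q \<le> t \<Longrightarrow> t < of_int Q' \<Longrightarrow> t * (psi r' t)\<^sup>2 \<le> \<theta> + \<epsilon>"
    "\<theta> - \<epsilon> \<le> of_int (Q' - 1) * (psi r' (of_int (Q' - 1)))\<^sup>2"
proof -
  note F' = F[unfolded lattice_frame_def]
  have Q: "Q > 0" and det: "of_int Q * (Re x * Im y - Im x * Re y) = 1"
    using F' by auto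
  have x0: "x \<noteq> 0"
    using det by auto
  \<comment> \<open>The first generator tends, after rescaling, to \<open>x\<close>; taking
    \<open>U = x / w\<close> makes \<open>x\<close> and \<open>U\<close> the two generators of the
    target shape.\<close>
  define w where "w = Complex (1/2) (- 1/\<theta>)"
  define U where "U = x / w"
  have w0: "w \<noteq> 0"
    by (simp add: w_def complex_eq_iff)
  have xU: "x = U * w" and U0: "U \<noteq> 0"
    using w0 x0 by (auto simp: U_def)
  have detU: "Re x * Im U - Im x * Re U = (cmod U)\<^sup>2 / \<theta>"
    unfolding xU w_def cmod_power2 using \<theta> by (simp add: field_simps power2_eq_square)
  \<comment> \<open>As \<open>R n\<close> grows like \<beta> Q n^2 and n \<open>Y n\<close> tends to
    \<open>U\<close>, this value makes \<open>R n\<close> |\<open>Y n\<close>|^2 tend to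
    \<theta>.\<close>
  define \<beta> where "\<beta> = \<theta> / (of_int Q * (cmod U)\<^sup>2)"
  have \<beta>: "\<beta> > 0"
    using \<theta> Q U0 by (simp add: \<beta>_def)
  have \<beta>Q: "\<beta> * of_int Q * (cmod U)\<^sup>2 = \<theta>"
    using Q U0 by (simp add: \<beta>_def)
  \<comment> \<open>By the choice of \<beta>, \<beta> U and \<open>y\<close> have the same
    determinant with \<open>x\<close>, so they differ by a real multiple of \<open>x\<close>; this
    is its coefficient.\<close>
  define \<tau> where "\<tau> = Re ((of_real \<beta> * U - y) / x)"
  have "of_int Q * (\<beta> * (Re x * Im U - Im x * Re U)) = of_int Q * (Re x * Im y - Im x * Re y)"
    unfolding det detU using \<theta> \<beta>Q by (simp add: field_simps)
  then have "\<beta> * (Re x * Im U - Im x * Re U) = Re x * Im y - Im x * Re y"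
    using Q by simp
  then have "Im ((of_real \<beta> * U - y) / x) = 0"
    by (simp add: Im_divide algebra_simps)
  then have "(of_real \<beta> * U - y) / x = of_real \<tau>"
    by (simp add: \<tau>_def complex_eq_iff)
  then have U\<tau>: "of_real \<beta> * U = y + of_real \<tau> * x"
    using x0 by (simp add: field_simps)
  define B where "B = (\<lambda>n::nat. \<lfloor>\<beta> * real n\<rfloor>)"
  define h where "h = (\<lambda>n::nat. \<lfloor>\<tau> * real n\<rfloor>)"
  define R where "R = (\<lambda>n. (int n * B n - h n) * Q - B n * a - b)"
  define \<delta> where "\<delta> = (\<lambda>n. (of_int (B n) * x + y) / of_int (R n))"
  define X where "X = (\<lambda>n. of_int Q * \<delta> n)"
  define Y where "Y = (\<lambda>n. of_int (int n * Q - a) * \<delta> n - x)"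
  have limR: "(\<lambda>n. of_int (R n) / (real n)\<^sup>2) \<longlonglongrightarrow> \<beta> * of_int Q"
    and limX: "(\<lambda>n. of_nat n * X n) \<longlonglongrightarrow> x"
    and limY: "(\<lambda>n. of_nat n * Y n) \<longlonglongrightarrow> U"
    using lattice_frame_asymptotics[OF F \<beta> U\<tau>]
    unfolding X_def Y_def \<delta>_def R_def B_def h_def by auto
  note in0 = lim_inverse_n[where 'a = real, unfolded inverse_eq_divide]
  define \<eta> where "\<eta> = (\<lambda>n. cmod (of_nat n * X n - x) + cmod (of_nat n * Y n - U))"
  have lim\<eta>: "\<eta> \<longlonglongrightarrow> 0"
  proof -
    have "\<eta> \<longlonglongrightarrow> cmod (x - x) + cmod (U - U)"
      unfolding \<eta>_def by (intro tendsto_intros limX limY)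
    then show ?thesis by simp
  qed
  \<comment> \<open>Requirements on \<open>n\<close>: a larger denominator (\<open>ev1\<close>), a
    small move of the point (\<open>ev2\<close>), the upper bound on two ranges of t
    (\<open>ev3\<close>, \<open>ev4\<close>), the lower bound (\<open>ev5\<close>), a small
    perturbation (\<open>ev6\<close>), a positive height n Q - a (\<open>ev7\<close>).\<close>
  have ev1: "\<forall>\<^sub>F n in sequentially. of_int Q * (1 / real n) * (1 / real n) < of_int (R n) / (real n)\<^sup>2"
  proof -
    have "(\<lambda>n. of_int (R n) / (real n)\<^sup>2 - of_int Q * (1 / real n) * (1 / real n)) \<longlonglongrightarrow> \<beta> * of_int Q - of_int Q * 0 * 0"
      by (intro tendsto_intros limR in0)
    from order_tendstoD(1)[OF this, of 0] \<beta> Q show ?thesis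
      by simp
  qed
  have ev2: "\<forall>\<^sub>F n in sequentially. cmod (of_nat n * X n) * (1 / real n) < \<epsilon> * of_int Q"
  proof -
    have "(\<lambda>n. cmod (of_nat n * X n) * (1 / real n)) \<longlonglongrightarrow> cmod x * 0"
      by (intro tendsto_intros limX in0)
    from order_tendstoD(2)[OF this, of "\<epsilon> * of_int Q"] \<epsilon> Q show ?thesis
      by simp
  qed
  have ev3: "\<forall>\<^sub>F n in sequentially. (of_int Q - of_int a * (1 / real n)) * (1 / real n) * (cmod (of_nat n * X n))\<^sup>2 < \<theta>"
  proof -
    have "(\<lambda>n. (of_int Q - of_int a * (1 / real n)) * (1 / real n) * (cmod (of_nat n * X n))\<^sup>2)
        \<longlonglongrightarrow> (of_int Q - of_int a * 0) * 0 * (cmod x)\<^sup>2"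
      by (intro tendsto_intros limX in0)
    from order_tendstoD(2)[OF this, of \<theta>] \<theta> show ?thesis
      by simp
  qed
  have ev4: "\<forall>\<^sub>F n in sequentially. of_int (R n) / (real n)\<^sup>2 * (cmod (of_nat n * Y n))\<^sup>2 < \<theta> + \<epsilon>"
  proof -
    have "(\<lambda>n. of_int (R n) / (real n)\<^sup>2 * (cmod (of_nat n * Y n))\<^sup>2) \<longlonglongrightarrow> \<beta> * of_int Q * (cmod U)\<^sup>2"
      by (intro tendsto_intros limR limY)
    from order_tendstoD(2)[OF this, of "\<theta> + \<epsilon>"] \<beta>Q \<epsilon> show ?thesis
      by simp
  qed
  have ev5: "\<forall>\<^sub>F n in sequentially. \<theta> - \<epsilon> <
      (of_int (R n) / (real n)\<^sup>2 - 1 / real n * (1 / real n)) * (cmod U - 2 * \<eta> n)\<^sup>2"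
  proof -
    have "(\<lambda>n. (of_int (R n) / (real n)\<^sup>2 - 1 / real n * (1 / real n)) * (cmod U - 2 * \<eta> n)\<^sup>2)
        \<longlonglongrightarrow> (\<beta> * of_int Q - 0 * 0) * (cmod U - 2 * 0)\<^sup>2"
      by (intro tendsto_intros limR lim\<eta> in0)
    from order_tendstoD(1)[OF this, of "\<theta> - \<epsilon>"] \<beta>Q \<epsilon> show ?thesis
      by simp
  qed
  have ev6: "\<forall>\<^sub>F n in sequentially. \<eta> n < cmod U / 2"
    using order_tendstoD(2)[OF lim\<eta>, of "cmod U / 2"] U0 by simp
  have ev7: "\<forall>\<^sub>F n in sequentially. nat (\<bar>a\<bar> + 1) \<le> n"
    by (rule eventually_ge_at_top)
  obtain n where n: "n > 0"
    and 1: "of_int Q * (1 / real n) * (1 / real n) < of_int (R n) / (real n)\<^sup>2"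
    and 2: "cmod (of_nat n * X n) * (1 / real n) < \<epsilon> * of_int Q"
    and 3: "(of_int Q - of_int a * (1 / real n)) * (1 / real n) * (cmod (of_nat n * X n))\<^sup>2 < \<theta>"
    and 4: "of_int (R n) / (real n)\<^sup>2 * (cmod (of_nat n * Y n))\<^sup>2 < \<theta> + \<epsilon>"
    and 5: "\<theta> - \<epsilon> < (of_int (R n) / (real n)\<^sup>2 - 1 / real n * (1 / real n)) * (cmod U - 2 * \<eta> n)\<^sup>2"
    and 6: "\<eta> n < cmod U / 2"
    and 7: "nat (\<bar>a\<bar> + 1) \<le> n"
    using eventually_happens[OF eventually_conj[OF eventually_gt_at_top[of 0]
      eventually_conj[OF ev1 eventually_conj[OF ev2 eventually_conj[OF ev3
        eventually_conj[OF ev4 eventually_conj[OF ev5 eventually_conj[OF ev6 ev7]]]]]]]]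
    by auto
  have "real_of_int Q < of_int (R n)"
    using 1 n by (simp add: field_simps power2_eq_square)
  then have RQ: "Q < R n"
    by simp
  have frame: "lattice_frame (R n) (r + \<delta> n) Q (int n * Q - a) (X n) (Y n)"
    unfolding X_def Y_def
    by (rule lattice_frame_step[OF F]) (use RQ Q in \<open>auto simp: R_def \<delta>_def\<close>)
  note FR = frame[unfolded lattice_frame_def]
  have b1: "1 \<le> int n * Q - a"
  proof -
    have "\<bar>a\<bar> + 1 \<le> int n" using 7 by linarith
    moreover have "int n * 1 \<le> int n * Q"
      using Q by (intro mult_left_mono) auto
    ultimately show ?thesis by linarith
  qed
  show ?thesis
  proof (rule that[OF frame RQ])
    have "cmod (X n) < \<epsilon> * of_int Q"
      using 2 n by (simp add: norm_mult)
    then show "cmod (r + \<delta> n - r) \<le> \<epsilon>"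
      using Q by (simp add: X_def norm_mult)
  next
    fix t :: real assume t: "of_int Q \<le> t" "t < of_int (R n)"
    have t1: "1 \<le> t" using t Q by linarith
    \<comment> \<open>Below the height n Q - a the vector \<open>X n\<close> suffices and gives a
      value of order 1/n; from there on \<open>Y n\<close> gives one tending to \<theta>.\<close>
    show "t * (psi (r + \<delta> n) t)\<^sup>2 \<le> \<theta> + \<epsilon>"
    proof (cases "t < of_int (int n * Q - a)")
      case True
      have "psi (r + \<delta> n) t \<le> cmod (X n)"
        by (rule psi_le_cmod[of Q]) (use Q t FR in auto)
      then have "t * (psi (r + \<delta> n) t)\<^sup>2 \<le> of_int (int n * Q - a) * (cmod (X n))\<^sup>2"
        using True t1 psi_nonneg[OF t1] by (intro mult_mono power_mono) auto
      also have "\<dots> = (of_int Q - of_int a * (1 / real n)) * (1 / real n) * (cmod (of_nat n * X n))\<^sup>2"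
        using n by (simp add: norm_mult power_mult_distrib power2_eq_square field_simps)
      finally show ?thesis
        using 3 \<epsilon> by linarith
    next
      case False
      have "psi (r + \<delta> n) t \<le> cmod (Y n)"
        by (rule psi_le_cmod[of "int n * Q - a"]) (use b1 False FR in auto)
      then have "t * (psi (r + \<delta> n) t)\<^sup>2 \<le> of_int (R n) * (cmod (Y n))\<^sup>2"
        using t t1 psi_nonneg[OF t1] by (intro mult_mono power_mono) auto
      also have "\<dots> = of_int (R n) / (real n)\<^sup>2 * (cmod (of_nat n * Y n))\<^sup>2"
        using n by (simp add: norm_mult power_mult_distrib)
      finally show ?thesis
        using 4 by linarith
    qed
  next
    \<comment> \<open>The last integer before the new denominator, at which \<open>psi\<close> drops
      to 0.\<close>
    define T where "T = real_of_int (R n - 1)"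
    have T1: "1 \<le> T"
      using RQ Q by (simp add: T_def)
    obtain q where q: "1 \<le> q" "real q \<le> T" "psi (r + \<delta> n) T = torus_norm (of_nat q * (r + \<delta> n))"
      using psi_attained[OF T1] .
    obtain g where g: "g \<in> gauss_ints" "torus_norm (of_nat q * (r + \<delta> n)) = cmod (of_nat q * (r + \<delta> n) - g)"
      using torus_norm_attained by blast
    obtain k i j where kij: "int q = k * R n + i * Q + j * (int n * Q - a)"
        "of_int (int q) * (r + \<delta> n) - g = of_int i * X n + of_int j * Y n"
      using FR g by blast
    \<comment> \<open>A vanishing planar part would make \<open>q\<close> a multiple of
      \<open>R n\<close>, although 1 \<le> q < \<open>R n\<close>.\<close>
    have ij: "i \<noteq> 0 \<or> j \<noteq> 0"
    proof (rule ccontr)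
      assume "\<not> (i \<noteq> 0 \<or> j \<noteq> 0)"
      then have "int q = k * R n" using kij by simp
      then have "R n dvd int q" by simp
      then have "R n \<le> int q"
        using q by (intro zdvd_imp_le) auto
      then show False
        using q by (simp add: T_def)
    qed
    have xUw: "U * Complex (1 / 2) (- (1 / \<theta>)) = x"
      by (simp add: xU w_def)
    have "cmod U - 2 * \<eta> n \<le> cmod (of_int i * (of_nat n * X n) + of_int j * (of_nat n * Y n))"
      by (rule perturbed_lattice_norm_ge[OF \<theta> ij])
        (use 6 xUw in \<open>auto simp: \<eta>_def\<close>)
    also have "\<dots> = cmod (of_nat n * (of_int i * X n + of_int j * Y n))"
      by (simp add: algebra_simps)
    also have "\<dots> = real n * psi (r + \<delta> n) T"
      using q(3) g(2) by (simp add: norm_mult flip: kij(2))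
    finally have "(cmod U - 2 * \<eta> n)\<^sup>2 \<le> (real n * psi (r + \<delta> n) T)\<^sup>2"
      using 6 by (intro power_mono) auto
    then have "(T / (real n)\<^sup>2) * (cmod U - 2 * \<eta> n)\<^sup>2 \<le> (T / (real n)\<^sup>2) * (real n * psi (r + \<delta> n) T)\<^sup>2"
      using T1 by (intro mult_left_mono) auto
    moreover have Tn: "T / (real n)\<^sup>2 = of_int (R n) / (real n)\<^sup>2 - 1 / real n * (1 / real n)"
      by (simp add: T_def diff_divide_distrib power2_eq_square)
    moreover have "(T / (real n)\<^sup>2) * (real n * psi (r + \<delta> n) T)\<^sup>2 = T * (psi (r + \<delta> n) T)\<^sup>2"
      using n by (simp add: power_mult_distrib)
    ultimately show "\<theta> - \<epsilon> \<le> of_int (R n - 1) * (psi (r + \<delta> n) (of_int (R n - 1)))\<^sup>2"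
      using 5[folded Tn] unfolding T_def by linarith
  qed
qed

text \<open>Iterating \<open>lattice_frame_next\<close> with tolerances tending to 0 gives rational
  points converging to some \<open>c\<close>. On each range between consecutive denominators the
  later point supplies the upper bound, and just before its denominator the lower one.\<close>

lemma limsup_t_psi_sq_attained:
  fixes \<theta> :: real
  assumes \<theta>: "0 < \<theta>" "\<theta> \<le> 2 / sqrt 3"
  shows "\<exists>c. Limsup at_top (\<lambda>t. ereal (t * (psi c t)\<^sup>2)) = ereal \<theta>"
proof -
  define good where "good = (\<lambda>s :: int \<times> complex.
    \<exists>a b x y. lattice_frame (fst s) (snd s) a b x y)"
  \<comment> \<open>The squared denominator offsets the t^2 of \<open>t_psi_sq_lipschitz\<close> for
    every t up to that denominator.\<close>
  define e where "e = (\<lambda>(k::nat) (s :: int \<times> complex). (1/2) ^ k / (of_int (fst s))\<^sup>2 :: real)"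
  define next_to where "next_to = (\<lambda>(k::nat) (s :: int \<times> complex) s'.
    fst s < fst s' \<and> cmod (snd s' - snd s) \<le> e k s \<and>
    (\<forall>t. of_int (fst s) \<le> t \<longrightarrow> t < of_int (fst s') \<longrightarrow> t * (psi (snd s') t)\<^sup>2 \<le> \<theta> + (1/2) ^ k) \<and>
    \<theta> - (1/2) ^ k \<le> of_int (fst s' - 1) * (psi (snd s') (of_int (fst s' - 1)))\<^sup>2)"
  have "\<exists>f. \<forall>k. good (f k) \<and> next_to k (f k) (f (Suc k))"
  proof (rule dependent_nat_choice)
    show "\<exists>s. good s"
      unfolding good_def using lattice_frame_init by (intro exI[of _ "(1, 0)"]) auto
  next
    fix s k assume "good s"
    then obtain a b x y where F: "lattice_frame (fst s) (snd s) a b x y"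
      by (auto simp: good_def)
    have Q: "fst s > 0"
      using F by (simp add: lattice_frame_def)
    then have "1 \<le> (real_of_int (fst s))\<^sup>2"
      by (intro one_le_power) linarith
    then have e: "e k s > 0" "e k s \<le> (1/2) ^ k"
      using Q divide_left_mono[of 1 "(real_of_int (fst s))\<^sup>2" "(1/2) ^ k"] by (auto simp: e_def)
    obtain Q' r' a' b' x' y' where *:
      "lattice_frame Q' r' a' b' x' y'" "fst s < Q'" "cmod (r' - snd s) \<le> e k s"
      "\<And>t. of_int (fst s) \<le> t \<Longrightarrow> t < of_int Q' \<Longrightarrow> t * (psi r' t)\<^sup>2 \<le> \<theta> + e k s"
      "\<theta> - e k s \<le> of_int (Q' - 1) * (psi r' (of_int (Q' - 1)))\<^sup>2"
      by (rule lattice_frame_next[OF F \<theta> e(1)]) (rule that; blast)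
    have "t * (psi r' t)\<^sup>2 \<le> \<theta> + (1/2) ^ k" if "of_int (fst s) \<le> t" "t < of_int Q'" for t
      using *(4)[OF that] e(2) by linarith
    moreover have "\<theta> - (1/2) ^ k \<le> of_int (Q' - 1) * (psi r' (of_int (Q' - 1)))\<^sup>2"
      using *(5) e(2) by linarith
    ultimately have "next_to k s (Q', r')"
      unfolding next_to_def using *(2,3) by simp
    moreover have "good (Q', r')"
      using *(1) by (auto simp: good_def)
    ultimately show "\<exists>s'. good s' \<and> next_to k s s'"
      by blast
  qed
  then obtain f where good: "\<And>k. good (f k)" and step: "\<And>k. next_to k (f k) (f (Suc k))"
    by blast
  define Q where "Q = (\<lambda>k. fst (f k))"
  define r where "r = (\<lambda>k. snd (f k))"
  have Qpos: "Q k > 0" for k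
    using good[of k] by (auto simp: good_def lattice_frame_def Q_def)
  have Qmono: "Q k < Q (Suc k)" for k
    using step[of k] by (simp add: next_to_def Q_def)
  have Qle: "Q k \<le> Q m" if "k \<le> m" for k m
    by (rule lift_Suc_mono_le[of Q, OF _ that]) (rule less_imp_le[OF Qmono])
  have Qk: "int k < Q k" for k
  proof (induction k)
    case 0
    show ?case using Qpos[of 0] by simp
  next
    case (Suc k)
    then show ?case using Qmono[of k] by simp
  qed
  have rstep: "cmod (r (Suc k) - r k) \<le> (1/2) ^ k / (of_int (Q k))\<^sup>2" for k
    using step[of k] by (simp add: next_to_def Q_def r_def e_def)
  \<comment> \<open>The exact partial sum of the geometric series is kept so that the induction
    closes.\<close>
  have rdist: "cmod (r (k + m) - r k) \<le> (2 - 2 * (1/2) ^ m) * ((1/2) ^ k / (of_int (Q k))\<^sup>2)" for k m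
  proof (induction m)
    case 0
    show ?case by simp
  next
    case (Suc m)
    have "(1/2) ^ (k + m) / (of_int (Q (k + m)))\<^sup>2 \<le> (1/2) ^ (k + m) / (real_of_int (Q k))\<^sup>2"
      using Qpos[of k] Qpos[of "k + m"] Qle[of k "k + m"]
      by (intro divide_left_mono power_mono mult_pos_pos) auto
    then have "cmod (r (Suc (k + m)) - r (k + m)) \<le> (1/2) ^ (k + m) / (real_of_int (Q k))\<^sup>2"
      using rstep[of "k + m"] by linarith
    also have "\<dots> = (1/2) ^ m * ((1/2) ^ k / (of_int (Q k))\<^sup>2)"
      by (simp add: power_add)
    finally have "cmod (r (k + Suc m) - r k) \<le>
        (1/2) ^ m * ((1/2) ^ k / (of_int (Q k))\<^sup>2) + (2 - 2 * (1/2) ^ m) * ((1/2) ^ k / (of_int (Q k))\<^sup>2)"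
      using Suc norm_triangle_ineq[of "r (Suc (k + m)) - r (k + m)" "r (k + m) - r k"] by simp
    also have "\<dots> = (2 - 2 * (1/2) ^ Suc m) * ((1/2) ^ k / (of_int (Q k))\<^sup>2)"
    proof -
      have "p * D + (2 - 2 * p) * D = (2 - p) * D" for p D :: real
        by (simp add: algebra_simps)
      moreover have "2 * (1/2) ^ Suc m = ((1/2) ^ m :: real)"
        by simp
      ultimately show ?thesis
        by (simp only:)
    qed
    finally show ?case .
  qed
  have rdist': "cmod (r (k + m) - r k) \<le> 2 * ((1/2) ^ k / (of_int (Q k))\<^sup>2)" for k m
    using rdist[of k m] by (rule order_trans) (intro mult_right_mono, auto)
  have "Cauchy r"
  proof (rule CauchyI')
    fix \<epsilon> :: real assume "\<epsilon> > 0"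
    then obtain M where M: "(1/2) ^ M < \<epsilon> / 2"
      using real_arch_pow_inv[of "\<epsilon> / 2" "1/2"] by auto
    have "dist (r m) (r n) < \<epsilon>" if "M \<le> m" "m < n" for m n
    proof -
      have "(1/2) ^ m / (of_int (Q m))\<^sup>2 \<le> ((1/2) ^ m :: real)"
      proof -
        have "1 \<le> (real_of_int (Q m))\<^sup>2"
          using Qpos[of m] by (intro one_le_power) linarith
        then show ?thesis
          using divide_left_mono[of 1 "(real_of_int (Q m))\<^sup>2" "(1/2) ^ m"] Qpos[of m] by simp
      qed
      also have "\<dots> \<le> (1/2) ^ M"
        using that by (intro power_decreasing) auto
      finally show ?thesis
        using rdist'[of m "n - m"] that M by (simp add: dist_norm norm_minus_commute)
    qed
    then show "\<exists>M. \<forall>m\<ge>M. \<forall>n>m. dist (r m) (r n) < \<epsilon>"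
      by blast
  qed
  then obtain c where c: "r \<longlonglongrightarrow> c"
    using Cauchy_convergent convergent_def by blast
  have cdist: "2 * (of_int (Q k))\<^sup>2 * cmod (c - r k) \<le> 4 * (1/2) ^ k" for k
  proof -
    have "(\<lambda>m. cmod (r (k + m) - r k)) \<longlonglongrightarrow> cmod (c - r k)"
      using LIMSEQ_ignore_initial_segment[OF c, of k]
      by (intro tendsto_intros) (simp add: add.commute)
    then have "cmod (c - r k) \<le> 2 * ((1/2) ^ k / (of_int (Q k))\<^sup>2)"
      by (rule LIMSEQ_le_const2) (intro exI allI impI rdist')
    then show ?thesis
      using Qpos[of k] by (simp add: field_simps)
  qed
  have close: "t * (psi c t)\<^sup>2 \<le> t * (psi (r k) t)\<^sup>2 + 4 * (1/2) ^ k"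
    "t * (psi (r k) t)\<^sup>2 \<le> t * (psi c t)\<^sup>2 + 4 * (1/2) ^ k"
    if t: "1 \<le> t" "t \<le> of_int (Q k)" for t k
  proof -
    have "2 * t\<^sup>2 * cmod (c - r k) \<le> 2 * (of_int (Q k))\<^sup>2 * cmod (c - r k)"
      using t by (intro mult_right_mono mult_left_mono power_mono) auto
    then have *: "2 * t\<^sup>2 * cmod (c - r k) \<le> 4 * (1/2) ^ k"
      using cdist[of k] by linarith
    show "t * (psi c t)\<^sup>2 \<le> t * (psi (r k) t)\<^sup>2 + 4 * (1/2) ^ k"
      using t_psi_sq_lipschitz[OF t(1), of c "r k"] * by linarith
    show "t * (psi (r k) t)\<^sup>2 \<le> t * (psi c t)\<^sup>2 + 4 * (1/2) ^ k"
      using t_psi_sq_lipschitz[OF t(1), of "r k" c] * by (simp add: norm_minus_commute)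
  qed
  \<comment> \<open>The 3 collects (1/2)^k from the step and 4 (1/2)^(k + 1) from replacing
    \<open>r (Suc k)\<close> by \<open>c\<close>, with k \<ge> K.\<close>
  have upper: "t * (psi c t)\<^sup>2 \<le> \<theta> + 3 * (1/2) ^ K" if t: "of_int (Q K) \<le> t" for t K
  proof -
    obtain N where N: "t < of_int (Q N)"
    proof -
      have "t < of_int (int (nat \<lceil>t\<rceil>) + 1)" by linarith
      also have "of_int (int (nat \<lceil>t\<rceil>) + 1) \<le> real_of_int (Q (nat \<lceil>t\<rceil>))"
        using Qk[of "nat \<lceil>t\<rceil>"] by (subst of_int_le_iff) simp
      finally show ?thesis using that by blast
    qed
    \<comment> \<open>Minimality puts \<open>t\<close> between two consecutive denominators, where
      \<open>next_to\<close> applies.\<close>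
    define n where "n = (LEAST n. t < of_int (Q n))"
    have n: "t < of_int (Q n)"
      unfolding n_def using N by (rule LeastI)
    have "K < n"
    proof (rule ccontr)
      assume "\<not> K < n"
      then have "real_of_int (Q n) \<le> of_int (Q K)"
        using Qle[of n K] by simp
      then show False using n t by linarith
    qed
    then obtain k where k: "n = Suc k" "K \<le> k"
      by (cases n) auto
    have "\<not> t < of_int (Q k)"
      using k(1) unfolding n_def by (metis lessI not_less_Least)
    then have "t * (psi (r n) t)\<^sup>2 \<le> \<theta> + (1/2) ^ k"
      using step[of k] n unfolding next_to_def Q_def r_def k(1) by auto
    moreover have "t * (psi c t)\<^sup>2 \<le> t * (psi (r n) t)\<^sup>2 + 4 * (1/2) ^ n"
    proof (rule close(1))
      show "1 \<le> t" using t Qpos[of K] by linarith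
    qed (use n in simp)
    moreover have "(1/2) ^ k \<le> ((1/2) ^ K :: real)"
      using k by (intro power_decreasing) auto
    moreover have "4 * (1/2) ^ n = (2 * (1/2) ^ k :: real)"
      by (simp add: k(1))
    ultimately show ?thesis
      by linarith
  qed
  define T where "T = (\<lambda>k. real_of_int (Q (Suc k) - 1))"
  have T: "real k \<le> T k" "1 \<le> T k" for k
    using Qk[of "Suc k"] Qpos[of k] Qmono[of k] by (auto simp: T_def)
  have lower: "\<theta> - 3 * (1/2) ^ k \<le> T k * (psi c (T k))\<^sup>2" for k
  proof -
    have "\<theta> - (1/2) ^ k \<le> T k * (psi (r (Suc k)) (T k))\<^sup>2"
      using step[of k] unfolding next_to_def T_def Q_def r_def by simp
    moreover have "T k * (psi (r (Suc k)) (T k))\<^sup>2 \<le> T k * (psi c (T k))\<^sup>2 + 4 * (1/2) ^ Suc k"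
      by (rule close(2)) (use T[of k] in \<open>auto simp: T_def\<close>)
    ultimately show ?thesis
      by simp
  qed
  have half: "(\<lambda>k. 3 * (1/2) ^ k) \<longlonglongrightarrow> (0::real)"
    using tendsto_mult_right_zero[OF LIMSEQ_power_zero[of "1/2::real"], of 3] by simp
  have "Limsup at_top (\<lambda>t. ereal (t * (psi c t)\<^sup>2)) = ereal \<theta>"
  proof (rule antisym)
    show "Limsup at_top (\<lambda>t. ereal (t * (psi c t)\<^sup>2)) \<le> ereal \<theta>"
    proof (rule ereal_le_epsilon2)
      fix \<epsilon> :: real assume "0 < \<epsilon>"
      from eventually_happens[OF order_tendstoD(2)[OF half this]]
      obtain K where K: "3 * (1/2) ^ K < \<epsilon>"
        by auto
      have "\<forall>\<^sub>F t in at_top. ereal (t * (psi c t)\<^sup>2) \<le> ereal \<theta> + ereal \<epsilon>"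
        using eventually_ge_at_top[of "real_of_int (Q K)"]
      proof eventually_elim
        case (elim t)
        show ?case
          using upper[OF elim] K by simp
      qed
      then show "Limsup at_top (\<lambda>t. ereal (t * (psi c t)\<^sup>2)) \<le> ereal \<theta> + ereal \<epsilon>"
        by (rule Limsup_bounded)
    qed
    show "ereal \<theta> \<le> Limsup at_top (\<lambda>t. ereal (t * (psi c t)\<^sup>2))"
    proof (rule ccontr)
      assume "\<not> ereal \<theta> \<le> Limsup at_top (\<lambda>t. ereal (t * (psi c t)\<^sup>2))"
      then obtain y where y: "Limsup at_top (\<lambda>t. ereal (t * (psi c t)\<^sup>2)) < ereal y" "y < \<theta>"
        using ereal_dense2[of "Limsup at_top (\<lambda>t. ereal (t * (psi c t)\<^sup>2))" "ereal \<theta>"]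
        by (auto simp: not_le)
      from Limsup_lessD[OF y(1)] obtain t0 where t0: "\<And>t. t0 \<le> t \<Longrightarrow> t * (psi c t)\<^sup>2 < y"
        by (auto simp: eventually_at_top_linorder)
      have "\<forall>\<^sub>F k in sequentially. 3 * (1/2) ^ k < \<theta> - y"
        using order_tendstoD(2)[OF half, of "\<theta> - y"] y by simp
      moreover have "\<forall>\<^sub>F k in sequentially. t0 \<le> real k"
        using eventually_ge_at_top[of "nat \<lceil>t0\<rceil>"] by eventually_elim linarith
      ultimately have "\<forall>\<^sub>F k in sequentially. 3 * (1/2) ^ k < \<theta> - y \<and> t0 \<le> real k"
        by (rule eventually_conj)
      from eventually_happens[OF this] obtain k where "3 * (1/2) ^ k < \<theta> - y" "t0 \<le> real k"
        by auto
      then show False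
        using lower[of k] t0[of "T k"] T(1)[of k] by linarith
    qed
  qed
  then show ?thesis
    by blast
qed

theorem theorem1:
  shows "dirichlet_spectrum_2 = {0 .. 2 / sqrt 3}"
proof (intro equalityI subsetI)
  fix l assume "l \<in> dirichlet_spectrum_2"
  then obtain v :: "real ^ 2" where
    "Limsup at_top (\<lambda>t. ereal (t * (irrationality_measure v t)\<^sup>2)) = ereal l"
    by (auto simp: dirichlet_spectrum_2_def)
  then obtain c where l: "Limsup at_top (\<lambda>t. ereal (t * (psi c t)\<^sup>2)) = ereal l"
    unfolding irrationality_measure_eq_psi by blast
  have "Limsup at_top (\<lambda>t. ereal (t * (psi c t)\<^sup>2)) \<le> ereal (2 / sqrt 3)"
    by (intro Limsup_bounded eventually_mono[OF eventually_ge_at_top[of 1]]) (simp add: t_psi_sq_le)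
  moreover have "0 \<le> Limsup at_top (\<lambda>t. ereal (t * (psi c t)\<^sup>2))"
    by (intro le_Limsup eventually_mono[OF eventually_ge_at_top[of 0]]) auto
  ultimately show "l \<in> {0 .. 2 / sqrt 3}"
    unfolding l by simp
next
  fix l :: real assume l: "l \<in> {0 .. 2 / sqrt 3}"
  have "\<exists>c. Limsup at_top (\<lambda>t. ereal (t * (psi c t)\<^sup>2)) = ereal l"
  proof (cases "l = 0")
    \<comment> \<open>The construction requires a positive value; 0 is realised by the point 0,
      whose \<open>psi\<close> vanishes from t = 1 on.\<close>
    case True
    have "psi 0 t = 0" if "1 \<le> t" for t
      using psi_le_cmod[of 1 t 0 0] psi_nonneg[OF that, of 0] that by (simp add: gauss_ints_0)
    then have "\<forall>\<^sub>F t in at_top. ereal (t * (psi 0 t)\<^sup>2) = 0"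
      by (intro eventually_mono[OF eventually_ge_at_top[of 1]]) simp
    then have "Limsup at_top (\<lambda>t. ereal (t * (psi 0 t)\<^sup>2)) = Limsup (at_top :: real filter) (\<lambda>_. 0)"
      by (rule Limsup_eq)
    then have "Limsup at_top (\<lambda>t. ereal (t * (psi 0 t)\<^sup>2)) = ereal l"
      using True by (simp add: Limsup_const)
    then show ?thesis ..
  next
    case False
    then show ?thesis
      using l by (intro limsup_t_psi_sq_attained) auto
  qed
  then obtain c where "Limsup at_top (\<lambda>t. ereal (t * (psi c t)\<^sup>2)) = ereal l" ..
  moreover have "irrationality_measure (vector [Re c, Im c]) = psi c"
    by (simp add: irrationality_measure_eq_psi)
  ultimately show "l \<in> dirichlet_spectrum_2"
    unfolding dirichlet_spectrum_2_def by (intro CollectI exI[of _ "vector [Re c, Im c]"]) simp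
qed

end
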